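(* Let $X$ be a Besicovitch metric space, $B=B(x,r)\subset X$ a ball, $\tilde B=B(x,3^{n+1}r)$, $\mu$ a Federer measure on $X$, and $\mathbf{f}:\tilde B\to\mathbb{R}^n$ a continuous map. Assume: (1) there exist $C,\alpha>0$ such that for all $k$ and all $\Gamma\in\mathfrak{P}(\mathbb{Z},n+1)$ the function $x\mapsto\operatorname{cov}(g_k u_{\mathbf{f}(x)}\Gamma)$ is $(C,\alpha)$-good on $\tilde B$ with respect to $\mu$; (2) there exist $c>0$ and a sequence $k_i\to\infty$ such that for every $i$ and every $\Gamma\in\mathfrak{P}(\mathbb{Z},n+1)$, $$\sup_{x\in B\cap\operatorname{supp}\mu}\operatorname{cov}(g_{k_i}u_{\mathbf{f}(x)}\Gamma)\ge c^{\operatorname{rank}(\Gamma)}.$$ Then $\mu(\{x\in B:\mathbf{f}(x)\text{ is singular}\})=0$.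
   Context: $\Vert\cdot\Vert$ is the max norm. $\mathbf{x}\in\mathbb{R}^n$ is singular if for every $c>0$ and all sufficiently large $Q>0$ there exist $\mathbf{0}\neq\mathbf{q}\in\mathbb{Z}^n$, $q_0\in\mathbb{Z}$ with $|\mathbf{q}\cdot\mathbf{x}+q_0|<c/Q^n$, $\Vert\mathbf{q}\Vert\le Q$. Besicovitch: there is $N_X$ such that for any bounded $A\subset X$ and any family $\mathcal{B}$ of nonempty open balls with every point of $A$ a center of some ball in $\mathcal{B}$, there is a countable subfamily $\{B_i\}$ with $1_A\le\sum_i1_{B_i}\le N_X$. Federer: for $\mu$-a.e. $x$ there are a neighborhood $U$ and $D>0$ with $\sup\{\mu(B(y,3\rho))/\mu(B(y,\rho)): y\in\operatorname{supp}\mu,\rho>0,B(y,3\rho)\subset U\}<D$. A function $f$ is $(C,\alpha)$-good on $V$ w.r.t. $\mu$ if for every open ball $B'\subset V$ centered in $\operatorname{supp}\mu$ and $\varepsilon>0$, $\mu(\{y\in B':|f(y)|<\varepsilon\})\le C(\varepsilon/\sup_{B'\cap\operatorname{supp}\mu}|f|)^\alpha\mu(B')$. $\mathfrak{P}(\mathbb{Z},n+1)$ is the set of nonzero primitive $\mathbb{Z}$-submodules $\Gamma$ of $\mathbb{Z}^{n+1}$ (i.e. $\Gamma=\mathbb{R}\Gamma\cap\mathbb{Z}^{n+1}$); $\operatorname{rank}(\Gamma)=\dim_{\mathbb{R}}\mathbb{R}\Gamma$. For a submodule $\Delta=\mathbb{Z}\mathbf{w}_1+\dots+\mathbb{Z}\mathbf{w}_r$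 of $\mathbb{R}^{n+1}$, $\operatorname{cov}(\Delta)=\Vert\mathbf{w}_1\wedge\dots\wedge\mathbf{w}_r\Vert$, where the norm on $\bigwedge^r\mathbb{R}^{n+1}$ is the max of the coordinates in the standard basis $\mathbf{e}_{i_1}\wedge\dots\wedge\mathbf{e}_{i_r}$ ($0\le i_1<\dots<i_r\le n$). For $\mathbf{y}\in\mathbb{R}^n$, $u_{\mathbf{y}}=\begin{bmatrix}1&\mathbf{y}\\0&I_n\end{bmatrix}$ and $g_k=\operatorname{diag}(e^{nk},e^{-k},\dots,e^{-k})$, $k\in\mathbb{N}$.
   Formalization: The formal statement additionally assumes that the ball B̃ has finite μ-measure (automatic for Radon measures on proper spaces such as R^d); without finiteness the claim as written fails, even for some locally finite measures. *)

theory Defs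
  imports "HOL-Analysis.Analysis"
begin

section \<open>Singular vectors\<close>

definition int_lattice :: "(real ^ 'm) set" where
  "int_lattice = {v. \<forall>i. v $ i \<in> \<int>}"

text \<open>\<^const>\<open>infnorm\<close> is the max norm.\<close>

definition singular_vector :: "real ^ 'n \<Rightarrow> bool" where
  "singular_vector x \<longleftrightarrow>
    (\<forall>c>0. \<forall>\<^sub>F Q :: real in at_top. \<exists>q\<in>int_lattice. \<exists>q0 :: int.
       q \<noteq> 0 \<and> \<bar>q \<bullet> x + of_int q0\<bar> < c / Q ^ CARD('n) \<and> infnorm q \<le> Q)"

section \<open>Besicovitch spaces, Federer measures, good functions\<close>

text \<open>
  A family of balls is a set of sets; since a ball of an abstract metric space may have several
  centres, ``\<open>a\<close> is a centre of a member of \<open>\<B>\<close>'' means that \<open>\<B>\<close> contains some \<open>ball a \<rho>\<close>.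
  The sum of indicators is taken in \<^typ>\<open>ennreal\<close>, where every family is summable.
\<close>

definition besicovitch_space :: "'a :: metric_space itself \<Rightarrow> bool" where
  "besicovitch_space _ \<longleftrightarrow>
    (\<exists>N :: nat. \<forall>(A :: 'a set) \<B>.
       bounded A \<longrightarrow>
       (\<forall>S\<in>\<B>. \<exists>y. \<exists>\<rho>>0. S = ball y \<rho>) \<longrightarrow>
       (\<forall>a\<in>A. \<exists>\<rho>>0. ball a \<rho> \<in> \<B>) \<longrightarrow>
       (\<exists>\<C>\<subseteq>\<B>. countable \<C> \<and>
          (\<forall>y. indicator A y \<le> (\<Sum>\<^sub>\<infinity>S\<in>\<C>. indicator S y :: ennreal) \<and>
               (\<Sum>\<^sub>\<infinity>S\<in>\<C>. indicator S y :: ennreal) \<le> of_nat N)))"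

definition msupp :: "'a :: topological_space measure \<Rightarrow> 'a set" where
  "msupp \<mu> = {x. \<forall>U. open U \<and> x \<in> U \<longrightarrow> emeasure \<mu> U > 0}"

definition federer_measure :: "'a :: metric_space measure \<Rightarrow> bool" where
  "federer_measure \<mu> \<longleftrightarrow>
    sets \<mu> = sets borel \<and>
    (AE x in \<mu>. \<exists>U. open U \<and> x \<in> U \<and> (\<exists>D>0.
       (SUP (y, \<rho>) \<in> {(y, \<rho>). y \<in> msupp \<mu> \<and> \<rho> > 0 \<and> ball y (3 * \<rho>) \<subseteq> U}.
          emeasure \<mu> (ball y (3 * \<rho>)) / emeasure \<mu> (ball y \<rho>)) < ennreal D))"

definition ennreal_powr :: "ennreal \<Rightarrow> real \<Rightarrow> ennreal" where
  "ennreal_powr t a = (if t = \<infinity> then \<infinity> else ennreal (enn2real t powr a))"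

text \<open>
  The supremum is formed in \<^typ>\<open>ennreal\<close>, so that for \<open>\<epsilon> > 0\<close> the quotient is \<open>0\<close> if the supremum
  is infinite and \<open>\<infinity>\<close> if it is \<open>0\<close>. Only meant for functions whose sublevel sets in \<open>V\<close> are
  \<open>\<mu>\<close>-measurable.
\<close>

definition good_on :: "real \<Rightarrow> real \<Rightarrow> 'a :: metric_space measure \<Rightarrow> 'a set \<Rightarrow> ('a \<Rightarrow> real) \<Rightarrow> bool" where
  "good_on C \<alpha> \<mu> V h \<longleftrightarrow>
    (\<forall>z\<in>msupp \<mu>. \<forall>\<rho>>0. ball z \<rho> \<subseteq> V \<longrightarrow>
      (\<forall>\<epsilon>>0. emeasure \<mu> {y \<in> ball z \<rho>. \<bar>h y\<bar> < \<epsilon>}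
         \<le> ennreal C
            * ennreal_powr (ennreal \<epsilon> / (SUP y \<in> ball z \<rho> \<inter> msupp \<mu>. ennreal \<bar>h y\<bar>)) \<alpha>
            * emeasure \<mu> (ball z \<rho>)))"

section \<open>Primitive submodules and covolume\<close>

definition int_scale :: "int \<Rightarrow> 'v :: real_vector \<Rightarrow> 'v" where
  "int_scale k v = of_int k *\<^sub>R v"

interpretation int_module: module int_scale
  by standard (simp_all add: int_scale_def scaleR_add_right scaleR_add_left)

definition primitive_submodules :: "(real ^ 'm) set set" where
  "primitive_submodules =
    {\<Gamma>. int_module.subspace \<Gamma> \<and> \<Gamma> \<noteq> {0} \<and> \<Gamma> = span \<Gamma> \<inter> int_lattice}"

text \<open>
  \<open>wedge_coord ws is\<close> is the coordinate of \<open>ws ! 0 \<and> \<dots> \<and> ws ! (r - 1)\<close> at the basis vector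
  \<open>e\<^bsub>is ! 0\<^esub> \<and> \<dots> \<and> e\<^bsub>is ! (r - 1)\<^esub>\<close>, an \<open>r \<times> r\<close> minor. The index type carries no order, so the
  maximum ranges over all lists of \<open>r\<close> distinct indices rather than only the increasing ones;
  reordering \<open>is\<close> merely changes the sign of the coordinate.
\<close>

definition wedge_coord :: "(real ^ 'm) list \<Rightarrow> 'm list \<Rightarrow> real" where
  "wedge_coord ws is =
    (\<Sum>p | p permutes {..<length ws}. of_int (sign p) * (\<Prod>j<length ws. ws ! j $ (is ! p j)))"

definition wedge_norm :: "(real ^ 'm) list \<Rightarrow> real" where
  "wedge_norm ws = Max {\<bar>wedge_coord ws is\<bar> | is. distinct is \<and> length is = length ws}"

definition lattice_basis :: "(real ^ 'm) list \<Rightarrow> (real ^ 'm) set \<Rightarrow> bool" where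
  "lattice_basis ws \<Delta> \<longleftrightarrow>
    distinct ws \<and> independent (set ws) \<and> \<Delta> = int_module.span (set ws)"

text \<open>
  Two bases of \<open>\<Delta>\<close> differ by an integer matrix of determinant \<open>\<plusminus>1\<close>, so the value does not depend
  on the basis chosen.
\<close>

definition cov :: "(real ^ 'm) set \<Rightarrow> real" where
  "cov \<Delta> = wedge_norm (SOME ws. lattice_basis ws \<Delta>)"

section \<open>The matrices \<open>g\<^sub>k\<close> and \<open>u\<^sub>y\<close>\<close>

text \<open>
  Vectors of dimension \<open>n + 1\<close> are indexed by \<^typ>\<open>'n option\<close>: \<^const>\<open>None\<close> is the index \<open>0\<close>,
  and \<open>Some i\<close> are the indices \<open>1, \<dots>, n\<close>.
\<close>

definition u_mat :: "real ^ 'n \<Rightarrow> real ^ ('n option) ^ ('n option)" where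
  "u_mat y = (\<chi> i j. case (i, j) of
      (None, None) \<Rightarrow> 1
    | (None, Some b) \<Rightarrow> y $ b
    | (Some a, None) \<Rightarrow> 0
    | (Some a, Some b) \<Rightarrow> (if a = b then 1 else 0))"

definition g_mat :: "nat \<Rightarrow> real ^ ('n option) ^ ('n :: finite option)" where
  "g_mat k = (\<chi> i j. if i = j
      then (case i of None \<Rightarrow> exp (real CARD('n) * real k) | Some _ \<Rightarrow> exp (- real k))
      else 0)"

end

theory Submission
  imports Defs "Jordan_Normal_Form.Determinant"
begin

text \<open>
  Covolumes of the primitive submodules form a family of good functions indexed by a poset of
  length \<open>n + 1\<close>. Call a point marked if some flag of submodules has covolumes in \<open>[\<epsilon>, \<rho>]\<close> there
  while every further submodule comparable with the flag has covolume at least \<open>\<rho>\<close>. At a marked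
  point the lattice \<open>g\<^sub>k u\<^sub>f \<int>\<^bsup>n+1\<^esup>\<close> has no nonzero vector of norm below \<open>\<epsilon> / (n + 1)\<close>. Following
  Kleinbock and Margulis, an induction on the length of the poset with Besicovitch coverings shows
  that the unmarked part of a small ball has relative mass \<open>O(\<epsilon>\<^sup>\<alpha>)\<close>, uniformly in \<open>k = k\<^sub>i\<close>.
  At a singular point the lattices have arbitrarily short vectors for all large \<open>k\<close>, so it is
  unmarked for all large \<open>i\<close>; let \<open>\<epsilon> \<rightarrow> 0\<close>. The Federer condition is only local, and goodness
  is what allows passing from \<open>B\<close> to small balls around almost every point.
\<close>

text \<open>The induction takes one submodule at a time. If some \<open>\<psi> s\<close> is below
  \<rho> at z, a ball about z is chosen on which s stays below \<rho> at all support points, while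
  on the tripled ball every function reaches \<rho>. Then s can join any flag found among the
  elements comparable with s, whose flags are shorter by one. The only new loss is the set where
  \<open>\<psi> s\<close> is below \<epsilon>, of relative mass at most C
  (\<epsilon>/\<rho>)^\<alpha> by goodness. Tripling has to be paid for by doubling with one
  constant D, so the induction runs inside a neighbourhood on which the Federer bound holds. There
  \<rho> has to be replaced by a smaller number depending on that neighbourhood. This is harmless:
  D, the radius and \<rho> are all fixed before i and \<epsilon>, and for fixed \<rho> the bound
  still tends to 0 with \<epsilon>. The set of marked points is not shown to be measurable; what is
  estimated is a measurable set containing the unmarked points of the ball.\<close>

no_notation vec_index (infixl "$" 100)

section \<open>Quantitative nondivergence for posets of functions\<close>

definition besicovitch_subcover :: "nat \<Rightarrow> 'a::metric_space set \<Rightarrow> ('a \<Rightarrow> real) \<Rightarrow> bool" where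
  "besicovitch_subcover N A R \<longleftrightarrow>
    (\<exists>Z\<subseteq>A. countable Z \<and> A \<subseteq> (\<Union>z\<in>Z. ball z (R z)) \<and>
       (\<forall>F y. finite F \<longrightarrow> F \<subseteq> Z \<longrightarrow>
          (\<Sum>z\<in>F. indicator (ball z (R z)) y :: ennreal) \<le> of_nat N))"

text \<open>Covers are indexed by centres because each centre later carries its own exceptional set.
  The subfamily consists of sets, and one set may be \<open>ball z (R z)\<close> for several z;
  keeping one centre per set makes \<open>b\<close> injective there, so the multiplicity bound
  passes from sets to centres.\<close>

lemma besicovitch_cover:
  assumes "besicovitch_space TYPE('a::metric_space)"
  obtains N :: nat where
    "\<And>(A::'a set) R. bounded A \<Longrightarrow> (\<And>z. z \<in> A \<Longrightarrow> R z > 0) \<Longrightarrow>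
       besicovitch_subcover N A R"
proof -
  obtain N :: nat where N: "\<And>(A :: 'a set) \<B>.
       bounded A \<Longrightarrow>
       (\<forall>S\<in>\<B>. \<exists>y. \<exists>\<rho>>0. S = ball y \<rho>) \<Longrightarrow>
       (\<forall>a\<in>A. \<exists>\<rho>>0. ball a \<rho> \<in> \<B>) \<Longrightarrow>
       (\<exists>\<C>\<subseteq>\<B>. countable \<C> \<and>
          (\<forall>y. indicator A y \<le> (\<Sum>\<^sub>\<infinity>S\<in>\<C>. indicator S y :: ennreal) \<and>
               (\<Sum>\<^sub>\<infinity>S\<in>\<C>. indicator S y :: ennreal) \<le> of_nat N))"
    using assms unfolding besicovitch_space_def by metis
  show thesis
  proof (rule that[of N])
    fix A :: "'a set" and R :: "'a \<Rightarrow> real"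
    assume bA: "bounded A" and R: "\<And>z. z \<in> A \<Longrightarrow> R z > 0"
    define b where "b z = ball z (R z)" for z
    have "\<exists>\<C>\<subseteq>b ` A. countable \<C> \<and>
          (\<forall>y. indicator A y \<le> (\<Sum>\<^sub>\<infinity>S\<in>\<C>. indicator S y :: ennreal) \<and>
               (\<Sum>\<^sub>\<infinity>S\<in>\<C>. indicator S y :: ennreal) \<le> of_nat N)"
      by (rule N[OF bA]) (use R in \<open>auto simp: b_def\<close>)
    then obtain \<C> where C: "\<C> \<subseteq> b ` A" "countable \<C>"
      and lo: "\<And>y. indicator A y \<le> (\<Sum>\<^sub>\<infinity>S\<in>\<C>. indicator S y :: ennreal)"
      and up: "\<And>y. (\<Sum>\<^sub>\<infinity>S\<in>\<C>. indicator S y :: ennreal) \<le> of_nat N"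
      by blast
    define g where "g = inv_into A b"
    have g: "g S \<in> A" "b (g S) = S" if "S \<in> \<C>" for S
      using that C(1) f_inv_into_f[of S b A] unfolding g_def
      by (auto intro: inv_into_into)
    show "besicovitch_subcover N A R"
      unfolding besicovitch_subcover_def
    proof (intro exI[of _ "g ` \<C>"] conjI allI impI)
      show "g ` \<C> \<subseteq> A" "countable (g ` \<C>)" using g C(2) by auto
      show "A \<subseteq> (\<Union>z\<in>g ` \<C>. ball z (R z))"
      proof
        fix y assume y: "y \<in> A"
        have "\<exists>S\<in>\<C>. y \<in> S"
        proof (rule ccontr)
          assume "\<not> (\<exists>S\<in>\<C>. y \<in> S)"
          then have "(\<Sum>\<^sub>\<infinity>S\<in>\<C>. indicator S y :: ennreal) = 0"
            by (intro infsum_0) auto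
          with lo[of y] y show False by simp
        qed
        then show "y \<in> (\<Union>z\<in>g ` \<C>. ball z (R z))"
          using g(2) unfolding b_def by blast
      qed
      fix F y assume F: "finite F" "F \<subseteq> g ` \<C>"
      have inj: "inj_on b F" by (rule inj_on_inverseI[of _ g]) (use F(2) g(2) in auto)
      have sub: "b ` F \<subseteq> \<C>" using F(2) g(2) by auto
      have "(\<Sum>z\<in>F. indicator (ball z (R z)) y :: ennreal) = (\<Sum>S\<in>b ` F. indicator S y)"
        by (simp add: sum.reindex[OF inj]) (simp add: b_def)
      also have "\<dots> = (\<Sum>\<^sub>\<infinity>S\<in>b ` F. indicator S y)" using F(1) by simp
      also have "\<dots> \<le> (\<Sum>\<^sub>\<infinity>S\<in>\<C>. indicator S y)"
        by (rule infsum_mono_neutral)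
          (use sub in \<open>auto intro: nonneg_summable_on_complete\<close>)
      also have "\<dots> \<le> of_nat N" by (rule up)
      finally show "(\<Sum>z\<in>F. indicator (ball z (R z)) y :: ennreal) \<le> of_nat N" .
    qed
  qed
qed

lemma emeasure_countable_UN_le:
  assumes "countable Z" and "\<And>z. z \<in> Z \<Longrightarrow> E z \<in> sets \<mu>"
    and "\<And>F. finite F \<Longrightarrow> F \<subseteq> Z \<Longrightarrow> (\<Sum>z\<in>F. emeasure \<mu> (E z)) \<le> b"
  shows "emeasure \<mu> (\<Union>z\<in>Z. E z) \<le> b"
proof (cases "Z = {}")
  case False
  define g where "g = from_nat_into Z"
  have g: "range g = Z" using False assms(1) by (simp add: g_def range_from_nat_into)
  define G where "G n = (\<Union>z\<in>g ` {..<n}. E z)" for n :: nat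
  have sG: "G n \<in> sets \<mu>" for n
    unfolding G_def using g assms(2) by (intro sets.finite_UN) auto
  have "(\<Union>z\<in>Z. E z) = (\<Union>n. G n)"
    unfolding G_def g[symmetric] by auto
  moreover have "emeasure \<mu> (\<Union>n. G n) = (SUP n. emeasure \<mu> (G n))"
    by (intro SUP_emeasure_incseq[symmetric]) (use sG in \<open>force simp: G_def incseq_def\<close>)+
  moreover have "emeasure \<mu> (G n) \<le> b" for n
  proof -
    have "emeasure \<mu> (G n) \<le> (\<Sum>z\<in>g ` {..<n}. emeasure \<mu> (E z))"
      unfolding G_def using g assms(2) by (intro emeasure_subadditive_finite) auto
    also have "\<dots> \<le> b" using g by (intro assms(3)) auto
    finally show ?thesis .
  qed
  ultimately show ?thesis by (simp add: SUP_least)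
qed simp

lemma sum_emeasure_le_multiplicity:
  assumes "finite F" and "\<And>z. z \<in> F \<Longrightarrow> S z \<in> sets \<mu>" and "\<And>z. z \<in> F \<Longrightarrow> S z \<subseteq> W" and "W \<in> sets \<mu>"
    and mult: "\<And>y. (\<Sum>z\<in>F. indicator (S z) y :: ennreal) \<le> of_nat N"
  shows "(\<Sum>z\<in>F. emeasure \<mu> (S z)) \<le> of_nat N * emeasure \<mu> W"
proof -
  have "(\<Sum>z\<in>F. emeasure \<mu> (S z)) = (\<Sum>z\<in>F. \<integral>\<^sup>+y. indicator (S z) y \<partial>\<mu>)"
    using assms(2) by simp
  also have "\<dots> = (\<integral>\<^sup>+y. (\<Sum>z\<in>F. indicator (S z) y) \<partial>\<mu>)"
    using assms(2) by (intro nn_integral_sum[symmetric]) auto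
  also have "\<dots> \<le> (\<integral>\<^sup>+y. of_nat N * indicator W y \<partial>\<mu>)"
  proof (rule nn_integral_mono)
    fix y
    show "(\<Sum>z\<in>F. indicator (S z) y) \<le> (of_nat N * indicator W y :: ennreal)"
    proof (cases "y \<in> W")
      case True
      then show ?thesis using mult[of y] by simp
    next
      case False
      then have "(\<Sum>z\<in>F. indicator (S z) y :: ennreal) = 0"
        using assms(3) by (intro sum.neutral) (auto simp: indicator_def)
      then show ?thesis by simp
    qed
  qed
  also have "\<dots> = of_nat N * emeasure \<mu> W"
    using assms(4) by (simp add: nn_integral_cmult_indicator)
  finally show ?thesis .
qed

lemma closed_msupp: "closed (msupp \<mu>)"
proof -
  have "open (- msupp \<mu>)"
    by (subst open_subopen) (auto simp: msupp_def not_less)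
  then show ?thesis by (simp add: closed_def)
qed

text \<open>Each point off the support has a null ball around it. The space is not assumed
  separable, so countably many such balls are extracted by a Besicovitch covering, which is where
  boundedness enters.\<close>

lemma null_diff_msupp:
  fixes \<mu> :: "'a :: metric_space measure"
  assumes "besicovitch_space TYPE('a)" "sets \<mu> = sets borel" "bounded V" "open V"
  shows "V - msupp \<mu> \<in> null_sets \<mu>"
proof -
  obtain N :: nat where N: "\<And>(A::'a set) R. bounded A \<Longrightarrow> (\<And>z. z \<in> A \<Longrightarrow> R z > 0) \<Longrightarrow>
       besicovitch_subcover N A R"
    by (rule besicovitch_cover[OF assms(1)]) blast
  let ?A = "V - msupp \<mu>"
  have "\<exists>R>0. emeasure \<mu> (ball z R) = 0" if "z \<in> ?A" for z
  proof -
    have "\<exists>U. open U \<and> z \<in> U \<and> emeasure \<mu> U = 0"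
      using that unfolding msupp_def by (auto simp: not_less)
    then obtain U where U: "open U" "z \<in> U" "emeasure \<mu> U = 0" by blast
    then obtain R where "R > 0" "ball z R \<subseteq> U" by (meson open_contains_ball)
    moreover from this U have "emeasure \<mu> (ball z R) \<le> emeasure \<mu> U"
      by (intro emeasure_mono) (auto simp: assms(2))
    ultimately show ?thesis using U(3) by auto
  qed
  then obtain R where R: "\<And>z. z \<in> ?A \<Longrightarrow> R z > 0 \<and> emeasure \<mu> (ball z (R z)) = 0" by metis
  have "besicovitch_subcover N ?A R"
    by (rule N) (use R assms(3) in \<open>auto intro: bounded_subset\<close>)
  then obtain Z where Z: "Z \<subseteq> ?A" "countable Z" "?A \<subseteq> (\<Union>z\<in>Z. ball z (R z))"
    unfolding besicovitch_subcover_def by blast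
  have "(\<Union>z\<in>Z. ball z (R z)) \<in> null_sets \<mu>"
    using Z(1,2) R by (intro null_sets_UN') (auto simp: null_sets_def assms(2))
  moreover have "?A \<in> sets \<mu>"
    using assms(4) closed_msupp[of \<mu>] by (auto simp: assms(2) intro: borel_open borel_closed)
  ultimately show ?thesis using Z(3) by (rule null_sets_subset)
qed

section \<open>Flags, marked points and the induction on the length of flags\<close>

definition comparable :: "'s::order \<Rightarrow> 's \<Rightarrow> bool" where
  "comparable s t \<longleftrightarrow> s \<le> t \<or> t \<le> s"

definition flags :: "'s::order set \<Rightarrow> 's set set" where
  "flags S = {F. finite F \<and> F \<subseteq> S \<and> (\<forall>s\<in>F. \<forall>t\<in>F. comparable s t)}"

definition marked :: "real \<Rightarrow> real \<Rightarrow> ('s::order \<Rightarrow> 'a \<Rightarrow> real) \<Rightarrow> 's set \<Rightarrow> 'a set" where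
  "marked \<epsilon> \<rho> \<psi> S = {y. \<exists>F\<in>flags S. (\<forall>s\<in>F. \<epsilon> \<le> \<psi> s y \<and> \<psi> s y \<le> \<rho>) \<and>
     (\<forall>t\<in>S - F. (\<forall>s\<in>F. comparable s t) \<longrightarrow> \<rho> \<le> \<psi> t y)}"

text \<open>Any \<open>t\<close> in S outside \<open>insert s F\<close> and comparable with all of
  it lies in the smaller poset, where the lower bound \<rho> for \<open>t\<close> is already
  known.\<close>

lemma marked_insert:
  assumes "s \<in> S" "y \<in> marked \<epsilon> \<rho> \<psi> {t \<in> S. t \<noteq> s \<and> comparable s t}" "\<epsilon> \<le> \<psi> s y" "\<psi> s y \<le> \<rho>"
  shows "y \<in> marked \<epsilon> \<rho> \<psi> S"
proof -
  let ?T = "{t \<in> S. t \<noteq> s \<and> comparable s t}"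
  obtain F where F: "F \<in> flags ?T" "\<forall>s\<in>F. \<epsilon> \<le> \<psi> s y \<and> \<psi> s y \<le> \<rho>"
    "\<forall>t\<in>?T - F. (\<forall>s\<in>F. comparable s t) \<longrightarrow> \<rho> \<le> \<psi> t y"
    using assms(2) unfolding marked_def by blast
  have "insert s F \<in> flags S" using F(1) assms(1) by (auto simp: flags_def comparable_def)
  then show ?thesis using F assms unfolding marked_def by (auto intro!: bexI[of _ "insert s F"])
qed

text \<open>This drives the induction: restoring \<open>s\<close> lengthens a flag by one.\<close>

lemma flags_comparable_card:
  assumes "\<And>F. F \<in> flags S \<Longrightarrow> card F \<le> Suc m" "s \<in> S"
    and F: "F \<in> flags {t \<in> S. t \<noteq> s \<and> comparable s t}"
  shows "card F \<le> m"
proof -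
  have "insert s F \<in> flags S" using F assms(2) by (auto simp: flags_def comparable_def)
  moreover have "s \<notin> F" "finite F" using F by (auto simp: flags_def)
  ultimately show ?thesis using assms(1)[of "insert s F"] by simp
qed

text \<open>In each step, N is the covering multiplicity, one D compares radius \<open>3 * t\<close>
  with \<open>t\<close> at a chosen centre, the other compares \<open>ball x (3 * r)\<close> with
  \<open>ball x r\<close>, and the summand 1 pays for the sublevel set of the chosen
  function.\<close>

primrec nondiv_const :: "nat \<Rightarrow> ennreal \<Rightarrow> nat \<Rightarrow> ennreal" where
  "nondiv_const N D 0 = 0"
| "nondiv_const N D (Suc m) = of_nat N * D * D * (nondiv_const N D m + 1)"

lemma nondiv_const_finite: "D < \<infinity> \<Longrightarrow> nondiv_const N D m < \<infinity>"
  by (induction m) (auto simp: ennreal_mult_less_top of_nat_less_top)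

text \<open>
  Choosing a radius \<open>t\<close> that is admissible for some \<open>s\<close> while \<open>3 * t\<close> is admissible for no \<open>s\<close>
  replaces the usual maximal radius, so no finiteness of \<open>{s. \<psi> s z < \<rho>}\<close> is needed.
\<close>

lemma critical_radius:
  fixes \<psi> :: "'s \<Rightarrow> 'a::metric_space \<Rightarrow> real" and z :: 'a
  assumes V: "z \<in> V" and usc: "\<And>s. s \<in> S \<Longrightarrow> open {y \<in> V. \<psi> s y < \<rho>}"
    and s0: "s0 \<in> S" "\<psi> s0 z < \<rho>"
    and big: "\<And>s. s \<in> S \<Longrightarrow> \<exists>y\<in>ball z b \<inter> M. \<rho> \<le> \<psi> s y"
  obtains s t where "s \<in> S" "0 < t" "t < b" "\<forall>y\<in>ball z t \<inter> M. \<psi> s y < \<rho>"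
    "\<And>s'. s' \<in> S \<Longrightarrow> \<exists>y\<in>ball z (3 * t) \<inter> M. \<rho> \<le> \<psi> s' y"
proof -
  define T where "T = {t. 0 < t \<and> (\<exists>s\<in>S. \<forall>y\<in>ball z t \<inter> M. \<psi> s y < \<rho>)}"
  have Tb: "t < b" if t: "t \<in> T" for t
  proof (rule ccontr)
    assume "\<not> t < b"
    then have "ball z b \<subseteq> ball z t" by (intro subset_ball) simp
    moreover obtain s where "s \<in> S" "\<forall>y\<in>ball z t \<inter> M. \<psi> s y < \<rho>"
      using t unfolding T_def by blast
    ultimately show False using big[of s] by (meson Int_iff leD subsetD)
  qed
  have "\<exists>t>0. ball z t \<subseteq> {y \<in> V. \<psi> s0 y < \<rho>}"
    using usc[OF s0(1)] V s0(2) by (simp add: open_contains_ball)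
  then obtain t0 where t0: "t0 > 0" "ball z t0 \<subseteq> {y \<in> V. \<psi> s0 y < \<rho>}" by blast
  then have t0T: "t0 \<in> T" using s0(1) unfolding T_def by blast
  have bdd: "bdd_above T" using Tb by (meson bdd_aboveI less_imp_le)
  have "Sup T \<ge> t0" using t0T bdd by (rule cSup_upper)
  \<comment> \<open>The supremum need not be attained; an admissible t above half of it is enough,
    since \<open>3 * t\<close> then exceeds the supremum.\<close>
  then have "Sup T / 2 < Sup T" using t0(1) by simp
  then obtain t where t: "t \<in> T" "Sup T / 2 < t"
    using t0T less_cSup_iff[OF _ bdd] by blast
  obtain s where s: "s \<in> S" "0 < t" "\<forall>y\<in>ball z t \<inter> M. \<psi> s y < \<rho>"
    using t(1) unfolding T_def by blast
  have "3 * t \<notin> T" using t(2) s(2) cSup_upper[OF _ bdd, of "3 * t"] by fastforce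
  then have "\<exists>y\<in>ball z (3 * t) \<inter> M. \<rho> \<le> \<psi> s' y" if "s' \<in> S" for s'
    using that s(2) unfolding T_def by force
  then show thesis using that[OF s(1,2) Tb[OF t(1)] s(3)] by blast
qed

lemma quantitative_nondivergence:
  fixes \<mu> :: "'a::metric_space measure" and \<psi> :: "'s::order \<Rightarrow> 'a \<Rightarrow> real" and D \<kappa> :: ennreal
  assumes sets: "sets \<mu> = sets borel"
    and supp: "V - msupp \<mu> \<in> null_sets \<mu>"
    and bes: "\<And>(A::'a set) R. bounded A \<Longrightarrow> (\<And>z. z \<in> A \<Longrightarrow> R z > 0) \<Longrightarrow>
       besicovitch_subcover N A R"
    and doubling: "\<And>y t. y \<in> msupp \<mu> \<Longrightarrow> t > 0 \<Longrightarrow> ball y (3 * t) \<subseteq> V \<Longrightarrow>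
       emeasure \<mu> (ball y (3 * t)) \<le> D * emeasure \<mu> (ball y t)"
    and good: "\<And>s z t. s \<in> S \<Longrightarrow> z \<in> msupp \<mu> \<Longrightarrow> t > 0 \<Longrightarrow> ball z t \<subseteq> V \<Longrightarrow>
       \<exists>y\<in>ball z t \<inter> msupp \<mu>. \<rho> \<le> \<psi> s y \<Longrightarrow>
       emeasure \<mu> {y \<in> ball z t. \<psi> s y < \<epsilon>} \<le> \<kappa> * emeasure \<mu> (ball z t)"
    and usc: "\<And>s e. s \<in> S \<Longrightarrow> open {y \<in> V. \<psi> s y < e}"
    and len: "\<And>F. F \<in> flags S \<Longrightarrow> card F \<le> m"
    and x: "x \<in> msupp \<mu>" "r > 0" "ball x (7 ^ m * r) \<subseteq> V"
    and big: "\<And>s. s \<in> S \<Longrightarrow> \<exists>y\<in>ball x r \<inter> msupp \<mu>. \<rho> \<le> \<psi> s y"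
  shows "\<exists>E\<in>sets \<mu>. ball x r \<subseteq> marked \<epsilon> \<rho> \<psi> S \<union> E \<and>
     emeasure \<mu> E \<le> nondiv_const N D m * \<kappa> * emeasure \<mu> (ball x r)"
  using good usc len x big
proof (induction m arbitrary: S x r)
  case 0
  have "S = {}"
  proof (rule ccontr)
    assume "S \<noteq> {}"
    then obtain s where "{s} \<in> flags S" by (auto simp: flags_def comparable_def)
    with "0.prems"(3)[of "{s}"] show False by simp
  qed
  then have "marked \<epsilon> \<rho> \<psi> S = UNIV" by (auto simp: marked_def flags_def)
  then show ?case by (intro bexI[of _ "{}"]) auto
next
  case (Suc m)
  note good = Suc.prems(1) and usc = Suc.prems(2) and len = Suc.prems(3)
    and x = Suc.prems(4-6) and big = Suc.prems(7)
  define M where "M = msupp \<mu>"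
  define c where "c = nondiv_const N D m"
  define below where "below s = {t \<in> S. t \<noteq> s \<and> comparable s t}" for s
  \<comment> \<open>A point of the ball outside A is either off the support, hence in a null set, or
    marked by the empty flag.\<close>
  define A where "A = {z \<in> ball x r \<inter> M. \<exists>s\<in>S. \<psi> s z < \<rho>}"
  have seven: "(7::real) ^ Suc m * r = 7 * (7 ^ m * r)" "7 ^ m * r \<ge> r"
    using x(2) by auto
  have subV: "ball x (3 * r) \<subseteq> V" "ball x r \<subseteq> V"
    using order_trans[OF subset_ball x(3), of "3 * r"] order_trans[OF subset_ball x(3), of r]
      seven x(2) by linarith+
  have loc: "\<exists>t E. 0 < t \<and> ball z t \<subseteq> ball x (3 * r) \<and> E \<in> sets \<mu> \<and>
      ball z t \<inter> M \<subseteq> marked \<epsilon> \<rho> \<psi> S \<union> E \<and>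
      emeasure \<mu> E \<le> (c + 1) * \<kappa> * D * emeasure \<mu> (ball z t)" if zA: "z \<in> A" for z
  proof -
    have zx: "z \<in> M" "dist x z < r" using zA by (auto simp: A_def)
    have zV: "z \<in> V" using zx subV(2) by auto
    obtain s0 where s0: "s0 \<in> S" "\<psi> s0 z < \<rho>" using zA by (auto simp: A_def)
    \<comment> \<open>Recentring at z doubles the radius on which all functions reach \<rho>; hence
      the critical radius is below \<open>2 * r\<close>.\<close>
    have "ball x r \<subseteq> ball z (2 * r)" using zx by metric
    then have big2: "\<exists>y\<in>ball z (2 * r) \<inter> M. \<rho> \<le> \<psi> s y" if "s \<in> S" for s
      using big[OF that] unfolding M_def by blast
    obtain s t where st: "s \<in> S" "0 < t" "t < 2 * r" "\<forall>y\<in>ball z t \<inter> M. \<psi> s y < \<rho>"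
      "\<And>s'. s' \<in> S \<Longrightarrow> \<exists>y\<in>ball z (3 * t) \<inter> M. \<rho> \<le> \<psi> s' y"
      by (rule critical_radius[where \<psi> = \<psi> and S = S and \<rho> = \<rho>, OF zV usc s0 big2]) blast+
    \<comment> \<open>The factor 7 is 1 + 6: z is within r of x, and the induction hypothesis is
      applied at radius \<open>3 * t\<close>, below \<open>6 * r\<close>.\<close>
    have "r + 7 ^ m * (6 * r) \<le> 7 ^ Suc m * r" using seven by (simp add: mult_ac)
    moreover have "7 ^ m * (3 * t) \<le> 7 ^ m * (6 * r)" using st(3) by simp
    ultimately have "ball z (7 ^ m * (3 * t)) \<subseteq> ball x (7 ^ Suc m * r)"
      using zx(2) by metric
    then have zV': "ball z (7 ^ m * (3 * t)) \<subseteq> V" using x(3) by blast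
    have "3 * t \<le> 7 ^ m * (3 * t)" using st(2) by simp
    then have z3V: "ball z (3 * t) \<subseteq> V" using zV' subset_ball by blast
    have "\<exists>E\<in>sets \<mu>. ball z (3 * t) \<subseteq> marked \<epsilon> \<rho> \<psi> (below s) \<union> E \<and>
       emeasure \<mu> E \<le> c * \<kappa> * emeasure \<mu> (ball z (3 * t))"
      unfolding c_def
    proof (rule Suc.IH)
      show "card F \<le> m" if "F \<in> flags (below s)" for F
        using flags_comparable_card[OF len st(1)] that unfolding below_def by blast
    qed (use good usc zx st zV' in \<open>auto simp: below_def M_def\<close>)
    then obtain E1 where E1: "E1 \<in> sets \<mu>" "ball z (3 * t) \<subseteq> marked \<epsilon> \<rho> \<psi> (below s) \<union> E1"
      "emeasure \<mu> E1 \<le> c * \<kappa> * emeasure \<mu> (ball z (3 * t))" by blast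
    define E2 where "E2 = {y \<in> ball z (3 * t). \<psi> s y < \<epsilon>}"
    have "E2 = ball z (3 * t) \<inter> {y \<in> V. \<psi> s y < \<epsilon>}" using z3V by (auto simp: E2_def)
    then have E2: "E2 \<in> sets \<mu>" using usc[OF st(1), of \<epsilon>] by (simp add: sets borel_open)
    have "emeasure \<mu> E2 \<le> \<kappa> * emeasure \<mu> (ball z (3 * t))"
      unfolding E2_def by (rule good) (use st zx z3V in \<open>auto simp: M_def\<close>)
    then have "emeasure \<mu> (E1 \<union> E2) \<le> (c + 1) * \<kappa> * emeasure \<mu> (ball z (3 * t))"
      using emeasure_subadditive[OF E1(1) E2] E1(3)
      by (auto simp: distrib_right intro: order_trans add_mono)
    \<comment> \<open>The covering will consist of balls of radius t, so the mass of the tripled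
      ball is brought back to that radius.\<close>
    also have "\<dots> \<le> (c + 1) * \<kappa> * (D * emeasure \<mu> (ball z t))"
      by (intro mult_left_mono doubling) (use zx st z3V in \<open>auto simp: M_def\<close>)
    finally have mE: "emeasure \<mu> (E1 \<union> E2) \<le> (c + 1) * \<kappa> * D * emeasure \<mu> (ball z t)"
      by (simp add: mult.assoc)
    have "ball z t \<inter> M \<subseteq> marked \<epsilon> \<rho> \<psi> S \<union> (E1 \<union> E2)"
    proof
      fix y assume y: "y \<in> ball z t \<inter> M"
      then have y3: "y \<in> ball z (3 * t)" using st(2) by auto
      show "y \<in> marked \<epsilon> \<rho> \<psi> S \<union> (E1 \<union> E2)"
      proof (cases "y \<in> E1 \<union> E2")
        case False
        then have "y \<in> marked \<epsilon> \<rho> \<psi> (below s)" "\<epsilon> \<le> \<psi> s y" "\<psi> s y \<le> \<rho>"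
          using E1(2) y y3 st(4) by (force simp: E2_def)+
        then have "y \<in> marked \<epsilon> \<rho> \<psi> S" unfolding below_def by (rule marked_insert[OF st(1)])
        then show ?thesis by simp
      qed simp
    qed
    moreover have "ball z t \<subseteq> ball x (3 * r)" using zx(2) st(3) by metric
    ultimately show ?thesis using mE E1(1) E2 st(2) by blast
  qed
  then obtain R where "\<And>z. z \<in> A \<Longrightarrow> \<exists>E. 0 < R z \<and> ball z (R z) \<subseteq> ball x (3 * r) \<and> E \<in> sets \<mu> \<and>
      ball z (R z) \<inter> M \<subseteq> marked \<epsilon> \<rho> \<psi> S \<union> E \<and>
      emeasure \<mu> E \<le> (c + 1) * \<kappa> * D * emeasure \<mu> (ball z (R z))" by metis
  then obtain E where R: "\<And>z. z \<in> A \<Longrightarrow> 0 < R z" "\<And>z. z \<in> A \<Longrightarrow> ball z (R z) \<subseteq> ball x (3 * r)"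
    and E: "\<And>z. z \<in> A \<Longrightarrow> E z \<in> sets \<mu>"
      "\<And>z. z \<in> A \<Longrightarrow> ball z (R z) \<inter> M \<subseteq> marked \<epsilon> \<rho> \<psi> S \<union> E z"
      "\<And>z. z \<in> A \<Longrightarrow> emeasure \<mu> (E z) \<le> (c + 1) * \<kappa> * D * emeasure \<mu> (ball z (R z))" by metis
  have "bounded A" by (rule bounded_subset[of "ball x r"]) (auto simp: A_def)
  then have "besicovitch_subcover N A R" using R(1) by (rule bes)
  then obtain Z where Z: "Z \<subseteq> A" "countable Z" "A \<subseteq> (\<Union>z\<in>Z. ball z (R z))"
    and mult: "\<And>F y. finite F \<Longrightarrow> F \<subseteq> Z \<Longrightarrow>
            (\<Sum>z\<in>F. indicator (ball z (R z)) y :: ennreal) \<le> of_nat N"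
    unfolding besicovitch_subcover_def by blast
  let ?b = "nondiv_const N D (Suc m) * \<kappa> * emeasure \<mu> (ball x r)"
  have UE: "emeasure \<mu> (\<Union>z\<in>Z. E z) \<le> ?b"
  proof (rule emeasure_countable_UN_le)
    fix F assume F: "finite F" "F \<subseteq> Z"
    have "(\<Sum>z\<in>F. emeasure \<mu> (E z)) \<le> (\<Sum>z\<in>F. (c + 1) * \<kappa> * D * emeasure \<mu> (ball z (R z)))"
      using F Z(1) E(3) by (intro sum_mono) auto
    also have "\<dots> = (c + 1) * \<kappa> * D * (\<Sum>z\<in>F. emeasure \<mu> (ball z (R z)))"
      by (simp add: sum_distrib_left)
    also have "\<dots> \<le> (c + 1) * \<kappa> * D * (of_nat N * emeasure \<mu> (ball x (3 * r)))"
      by (intro mult_left_mono sum_emeasure_le_multiplicity)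
        (use F Z(1) R(2) mult in \<open>auto simp: sets\<close>)
    also have "\<dots> \<le> (c + 1) * \<kappa> * D * (of_nat N * (D * emeasure \<mu> (ball x r)))"
      by (intro mult_left_mono doubling) (use x subV in auto)
    also have "\<dots> = ?b" by (simp add: c_def mult_ac)
    finally show "(\<Sum>z\<in>F. emeasure \<mu> (E z)) \<le> ?b" .
  qed (use Z E in auto)
  have sUE: "(\<Union>z\<in>Z. E z) \<in> sets \<mu>" using Z E by (intro sets.countable_UN') auto
  have "ball x r \<subseteq> marked \<epsilon> \<rho> \<psi> S \<union> ((\<Union>z\<in>Z. E z) \<union> (V - M))"
  proof
    fix y assume y: "y \<in> ball x r"
    consider "y \<in> A" | "y \<notin> M" | "y \<in> M" "y \<notin> A" by blast
    then show "y \<in> marked \<epsilon> \<rho> \<psi> S \<union> ((\<Union>z\<in>Z. E z) \<union> (V - M))"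
    proof cases
      case 1
      then obtain z where "z \<in> Z" "y \<in> ball z (R z) \<inter> M" using Z(3) by (auto simp: A_def)
      then show ?thesis using E(2)[of z] Z(1) by blast
    next
      case 2
      then show ?thesis using y subV by auto
    next
      case 3
      then have "{} \<in> flags S" "\<forall>s\<in>S. \<rho> \<le> \<psi> s y" using y by (auto simp: A_def flags_def)
      then have "y \<in> marked \<epsilon> \<rho> \<psi> S" by (auto simp: marked_def intro!: bexI[of _ "{}"])
      then show ?thesis by simp
    qed
  qed
  moreover have "emeasure \<mu> ((\<Union>z\<in>Z. E z) \<union> (V - M)) = emeasure \<mu> (\<Union>z\<in>Z. E z)"
    using supp sUE by (simp add: M_def emeasure_Un_null_set)
  ultimately show ?case using UE sUE supp
    by (intro bexI[of _ "(\<Union>z\<in>Z. E z) \<union> (V - M)"]) (auto simp: M_def)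
qed

section \<open>Covolumes of lattices\<close>

lemma int_module_span_subset_span: "int_module.span S \<subseteq> span S"
proof (rule int_module.span_minimal)
  show "int_module.subspace (span S)"
    by (rule int_module.subspaceI) (auto simp: int_scale_def span_add span_scale span_zero)
qed (simp add: span_superset)

lemma int_lattice_coordE:
  assumes "v \<in> int_lattice"
  obtains a :: int where "v $ i = of_int a"
proof -
  have "v $ i \<in> \<int>" using assms by (simp add: int_lattice_def)
  then show thesis using that by (rule Ints_cases)
qed

text \<open>Induction on the set I of coordinates that may be nonzero. The i-th coordinates of
  \<Gamma> form an ideal of the integers; a vector attaining its positive generator, together with a
  basis of the part where that coordinate vanishes, generates \<Gamma>.\<close>

lemma int_submodule_generators:
  fixes \<Gamma> :: "(real ^ 'm) set"
  assumes "finite I" "\<Gamma> \<subseteq> int_lattice" "int_module.subspace \<Gamma>"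
    and "\<And>v i. v \<in> \<Gamma> \<Longrightarrow> i \<notin> I \<Longrightarrow> v $ i = 0"
  shows "\<exists>B. finite B \<and> independent B \<and> \<Gamma> = int_module.span B"
  using assms
proof (induction I arbitrary: \<Gamma> rule: finite_induct)
  case empty
  have "\<Gamma> \<subseteq> {0}"
  proof
    fix v assume "v \<in> \<Gamma>"
    then have "v $ i = 0" for i using empty(3) by blast
    then show "v \<in> {0}" by (simp add: Finite_Cartesian_Product.vec_eq_iff)
  qed
  then have "\<Gamma> = int_module.span {}"
    using int_module.subspace_0[OF empty(2)] by auto
  then show ?case by (intro exI[of _ "{}"]) (auto simp: independent_empty)
next
  case (insert i I)
  note sub = \<open>int_module.subspace \<Gamma>\<close> and lat = \<open>\<Gamma> \<subseteq> int_lattice\<close>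
  show ?case
  proof (cases "\<forall>v\<in>\<Gamma>. v $ i = 0")
    case True
    then have "\<And>v j. v \<in> \<Gamma> \<Longrightarrow> j \<notin> I \<Longrightarrow> v $ j = 0" using insert.prems(3) by (metis insertE)
    then show ?thesis by (rule insert.IH[OF lat sub])
  next
    case False
    define P where "P k \<longleftrightarrow> 0 < k \<and> (\<exists>v\<in>\<Gamma>. v $ i = of_nat k)" for k :: nat
    obtain v where v: "v \<in> \<Gamma>" "v $ i \<noteq> 0" using False by blast
    obtain a :: int where a: "v $ i = of_int a"
      using int_lattice_coordE lat v(1) by blast
    have "P (nat \<bar>a\<bar>)"
    proof (cases "a > 0")
      case True
      then show ?thesis using v a unfolding P_def by (auto intro!: bexI[of _ v])
    next
      case False
      moreover have "- v \<in> \<Gamma>" using sub v(1) by (rule int_module.subspace_neg)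
      ultimately show ?thesis using v a unfolding P_def by (auto intro!: bexI[of _ "- v"])
    qed
    then have "P (LEAST k. P k)" by (rule LeastI)
    then obtain d w where d: "0 < d" "w \<in> \<Gamma>" "w $ i = of_nat d" "d = (LEAST k. P k)"
      unfolding P_def by blast
    define \<Gamma>' where "\<Gamma>' = {v \<in> \<Gamma>. v $ i = 0}"
    have sub': "int_module.subspace \<Gamma>'"
      unfolding \<Gamma>'_def using sub by (auto simp: int_module.subspace_def int_scale_def)
    have "\<exists>B. finite B \<and> independent B \<and> \<Gamma>' = int_module.span B"
    proof (rule insert.IH[OF _ sub'])
      show "\<Gamma>' \<subseteq> int_lattice" using lat by (auto simp: \<Gamma>'_def)
      show "v $ j = 0" if "v \<in> \<Gamma>'" "j \<notin> I" for v j
        using that insert.prems(3)[of v j] by (cases "j = i") (auto simp: \<Gamma>'_def)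
    qed
    then obtain B where B: "finite B" "independent B" "\<Gamma>' = int_module.span B" by blast
    have "B \<subseteq> {v. v $ i = 0}"
      using int_module.span_superset[of B] B(3) by (auto simp: \<Gamma>'_def)
    moreover have "subspace {v :: real ^ 'm. v $ i = 0}" by (auto simp: subspace_def)
    ultimately have "span B \<subseteq> {v. v $ i = 0}" by (rule span_minimal)
    then have "w \<notin> span B" using d by auto
    then have ind: "independent (insert w B)" using B(2) by (rule independent_insertI)
    have "\<Gamma> = int_module.span (insert w B)"
    proof
      show "int_module.span (insert w B) \<subseteq> \<Gamma>"
        using d(2) int_module.span_superset[of B] B(3) sub
        by (intro int_module.span_minimal) (auto simp: \<Gamma>'_def)
      show "\<Gamma> \<subseteq> int_module.span (insert w B)"
      proof
        fix u assume u: "u \<in> \<Gamma>"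
        obtain a :: int where a: "u $ i = of_int a"
          using int_lattice_coordE lat u by blast
        \<comment> \<open>Division with remainder: coordinate i of \<open>u'\<close> is
          \<open>a mod int d\<close>, which is below d and so vanishes by minimality of d.\<close>
        define u' where "u' = u - int_scale (a div int d) w"
        have u': "u' \<in> \<Gamma>" unfolding u'_def
          by (intro int_module.subspace_diff int_module.subspace_scale sub u d(2))
        have "u' $ i = of_int (a - (a div int d) * int d)"
          by (simp add: u'_def int_scale_def a d(3))
        then have "u' $ i = of_int (a mod int d)" by (simp add: minus_div_mult_eq_mod)
        then have "u' $ i = of_nat (nat (a mod int d))" using d(1) by simp
        then have "\<not> P (nat (a mod int d)) \<Longrightarrow> u' $ i = 0" using u' unfolding P_def by auto
        moreover have "\<not> P (nat (a mod int d))"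
          using d(1,4) not_less_Least[of "nat (a mod int d)" P] by (simp add: nat_less_iff)
        ultimately have "u' \<in> int_module.span B" using u' B(3) by (auto simp: \<Gamma>'_def)
        then show "u \<in> int_module.span (insert w B)"
          unfolding int_module.span_breakdown_eq u'_def by blast
      qed
    qed
    then show ?thesis using ind B(1) by blast
  qed
qed

lemma lattice_basis_exists:
  assumes "\<Gamma> \<subseteq> int_lattice" "int_module.subspace \<Gamma>"
  obtains ws where "lattice_basis ws \<Gamma>"
proof -
  have "\<exists>B. finite B \<and> independent B \<and> \<Gamma> = int_module.span B"
    by (rule int_submodule_generators[of UNIV]) (use assms in auto)
  then obtain B where B: "finite B" "independent B" "\<Gamma> = int_module.span B" by blast
  obtain ws where "set ws = B" "distinct ws" using finite_distinct_list[OF B(1)] by blast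
  then show thesis using that B unfolding lattice_basis_def by blast
qed

lemma lattice_basis_image:
  assumes "linear h" "inj h" "lattice_basis ws \<Gamma>"
  shows "lattice_basis (map h ws) (h ` \<Gamma>)"
proof -
  interpret linear h by fact
  have "module_hom int_scale int_scale h"
    by (intro module_hom.intro module_hom_axioms.intro int_module.module_axioms)
      (auto simp: int_scale_def add scale)
  then have "int_module.span (h ` set ws) = h ` int_module.span (set ws)"
    by (rule module_hom.span_image)
  moreover have "independent (h ` set ws)"
    using assms by (intro linear_independent_injective_image) (auto simp: lattice_basis_def intro: inj_on_subset)
  ultimately show ?thesis using assms(2,3)
    by (auto simp: lattice_basis_def distinct_map intro: inj_on_subset)
qed

lemma lattice_basis_length:
  assumes "lattice_basis ws \<Delta>"
  shows "length ws = dim \<Delta>"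
proof -
  have "span \<Delta> = span (set ws)"
    using assms int_module.span_superset[of "set ws"] int_module_span_subset_span[of "set ws"]
    unfolding lattice_basis_def by (metis span_mono span_span subset_antisym)
  then have "dim \<Delta> = dim (set ws)" by (metis dim_span)
  then show ?thesis using assms unfolding lattice_basis_def
    by (metis dim_eq_card_independent distinct_card)
qed

lemma independent_list_length:
  fixes ws :: "(real ^ 'm) list"
  assumes "distinct ws" "independent (set ws)"
  shows "length ws \<le> CARD('m)"
  using independent_bound[OF assms(2)] distinct_card[OF assms(1)] by simp

lemma sum_list_nth_set:
  assumes "distinct ws"
  shows "(\<Sum>v\<in>set ws. g v) = (\<Sum>j<length ws. g (ws ! j))"
  using sum.reindex_bij_betw[OF bij_betw_nth[OF assms refl refl], of g] by simp

lemma int_span_list_coeffs: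
  assumes "distinct ws" "v \<in> int_module.span (set ws)"
  obtains c :: "nat \<Rightarrow> real" where "\<And>j. c j \<in> \<int>" "v = (\<Sum>j<length ws. c j *\<^sub>R ws ! j)"
proof -
  obtain u where "v = (\<Sum>x\<in>set ws. int_scale (u x) x)"
    using assms(2) by (auto simp: int_module.span_finite)
  then have "v = (\<Sum>j<length ws. of_int (u (ws ! j)) *\<^sub>R ws ! j)"
    using assms(1) by (simp add: sum_list_nth_set int_scale_def)
  then show thesis by (intro that[of "\<lambda>j. of_int (u (ws ! j))"]) auto
qed

lemma independent_list_coeffs_zero:
  assumes "distinct ws" "independent (set ws)" "(\<Sum>j<length ws. c j *\<^sub>R ws ! j) = 0" "j < length ws"
  shows "c j = 0"
proof -
  define u where "u v = c (inv_into {..<length ws} ((!) ws) v)" for v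
  have inj: "inj_on ((!) ws) {..<length ws}" using assms(1) by (simp add: inj_on_nth)
  have u: "u (ws ! j) = c j" if "j < length ws" for j
    using that inj by (simp add: u_def inv_into_f_f)
  have "(\<Sum>v\<in>set ws. u v *\<^sub>R v) = 0"
    using assms(1,3) u by (simp add: sum_list_nth_set)
  then have "u (ws ! j) = 0"
    by (rule independentD[OF assms(2) finite_set subset_refl]) (use assms(4) in simp)
  then show ?thesis using u assms(4) by simp
qed

section \<open>Wedge coordinates as minors, and independence of the covolume from the basis\<close>

lemma permutes_lessThan: "p permutes {..<r} \<Longrightarrow> i < r \<Longrightarrow> p i < (r::nat)"
  by (metis lessThan_iff permutes_in_image)

text \<open>The defining sum is the Leibniz formula; this makes multiplicativity and Laplace
  expansion available.\<close>

lemma wedge_coord_det: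
  assumes "length ws = r"
  shows "wedge_coord ws is = Determinant.det (Matrix.mat r r (\<lambda>(j, k). ws ! j $ (is ! k)))"
  unfolding wedge_coord_def Determinant.det_def using assms
  by (auto simp: atLeast0LessThan permutes_lessThan intro!: sum.cong prod.cong)

lemma wedge_coord_transform:
  assumes "length ws = r" "length ws' = r" "\<And>j. j < r \<Longrightarrow> ws' ! j = (\<Sum>k<r. A j k *\<^sub>R ws ! k)"
  shows "wedge_coord ws' is = Determinant.det (Matrix.mat r r (\<lambda>(j, k). A j k)) * wedge_coord ws is"
proof -
  have "Matrix.mat r r (\<lambda>(j, k). ws' ! j $ (is ! k)) =
    Matrix.mat r r (\<lambda>(j, k). A j k) * Matrix.mat r r (\<lambda>(j, k). ws ! j $ (is ! k))"
    by (rule eq_matI)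
      (auto simp: assms(3) scalar_prod_def atLeast0LessThan sum_component)
  then show ?thesis
    by (simp add: wedge_coord_det[OF assms(1)] wedge_coord_det[OF assms(2)] det_mult[of _ r])
qed

lemma det_Ints:
  assumes "\<And>j k. A j k \<in> \<int>"
  shows "Determinant.det (Matrix.mat r r (\<lambda>(j, k). A j k :: real)) \<in> \<int>"
  unfolding Determinant.det_def
  by (auto simp: assms atLeast0LessThan permutes_lessThan intro!: Ints_sum Ints_mult Ints_prod)

text \<open>A nonzero kernel vector of the transpose would be a linear relation among the vectors of
  \<open>ws'\<close>.\<close>

lemma independent_imp_det_nonzero:
  assumes len: "length ws = r" "length ws' = r" and A: "\<And>j. j < r \<Longrightarrow> ws' ! j = (\<Sum>k<r. A j k *\<^sub>R ws ! k)"
    and ind: "distinct ws'" "independent (set ws')"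
  shows "Determinant.det (Matrix.mat r r (\<lambda>(j, k). A j k :: real)) \<noteq> 0"
proof
  let ?M = "Matrix.mat r r (\<lambda>(j, k). A j k)"
  assume "Determinant.det ?M = 0"
  then have "Determinant.det (transpose_mat ?M) = 0" by (simp add: det_transpose[of _ r])
  then obtain c where c: "c \<in> carrier_vec r" "c \<noteq> 0\<^sub>v r" "transpose_mat ?M *\<^sub>v c = 0\<^sub>v r"
    by (subst (asm) det_0_iff_vec_prod_zero_field[of _ r]) auto
  have zero: "(\<Sum>j<r. vec_index c j * A j k) = 0" if "k < r" for k
  proof -
    have "vec_index (transpose_mat ?M *\<^sub>v c) k = 0" using c(3) that by simp
    then show ?thesis using that c(1) by (simp add: scalar_prod_def atLeast0LessThan mult.commute)
  qed
  have "(\<Sum>j<r. vec_index c j *\<^sub>R ws' ! j) = (\<Sum>j<r. \<Sum>k<r. (vec_index c j * A j k) *\<^sub>R ws ! k)"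
    by (simp add: A scaleR_sum_right)
  also have "\<dots> = (\<Sum>k<r. (\<Sum>j<r. vec_index c j * A j k) *\<^sub>R ws ! k)"
    by (subst sum.swap) (simp add: scaleR_sum_left)
  also have "\<dots> = 0" by (simp add: zero)
  finally have "vec_index c j = 0" if "j < r" for j
    using independent_list_coeffs_zero[OF ind, of "vec_index c" j] that len(2) by simp
  then have "c = 0\<^sub>v r" using c(1) by (intro eq_vecI) auto
  with c(2) show False by simp
qed

lemma finite_wedge_coords: "finite {\<bar>wedge_coord ws is\<bar> | is. distinct is \<and> length is = length (ws :: (real ^ 'm) list)}"
proof -
  have "finite {is :: 'm list. set is \<subseteq> UNIV \<and> length is = length ws}"
    by (rule finite_lists_length_eq) simp
  then have "finite ((\<lambda>is. \<bar>wedge_coord ws is\<bar>) ` {is :: 'm list. distinct is \<and> length is = length ws})"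
    by (rule finite_imageI[OF finite_subset, rotated]) auto
  then show ?thesis by (simp add: setcompr_eq_image)
qed

lemma wedge_coord_le_norm:
  assumes "distinct is" "length is = length ws"
  shows "\<bar>wedge_coord ws is\<bar> \<le> wedge_norm ws"
  unfolding wedge_norm_def by (rule Max_ge[OF finite_wedge_coords]) (use assms in blast)

lemma exists_distinct_index_list:
  assumes "r \<le> CARD('m::finite)"
  shows "\<exists>is :: 'm list. distinct is \<and> length is = r"
proof -
  obtain xs :: "'m list" where xs: "set xs = UNIV" "distinct xs"
    using finite_distinct_list[OF finite_class.finite_UNIV] by blast
  then have "length (take r xs) = r" using assms distinct_card[of xs] by simp
  then show ?thesis using xs(2) distinct_take by blast
qed

text \<open>The length bound supplies a list of distinct indices; without one, \<open>Max\<close>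
  would be taken over the empty set.\<close>

lemma wedge_norm_attained:
  fixes ws :: "(real ^ 'm) list"
  assumes "length ws \<le> CARD('m)"
  obtains "is" where "distinct is" "length is = length ws" "wedge_norm ws = \<bar>wedge_coord ws is\<bar>"
proof -
  have "{\<bar>wedge_coord ws is\<bar> | is. distinct is \<and> length is = length ws} \<noteq> {}"
    using exists_distinct_index_list[OF assms] by blast
  from Max_in[OF finite_wedge_coords this] show thesis
    using that unfolding wedge_norm_def by blast
qed

text \<open>The transition matrix is integral and nonsingular, so its determinant, up to sign the
  index of the sublattice, has modulus at least 1; it multiplies every coordinate alike.\<close>

lemma wedge_norm_mono_sublattice:
  fixes ws ws' :: "(real ^ 'm) list"
  assumes "distinct ws" "independent (set ws)" "length ws' = length ws"
    and "distinct ws'" "independent (set ws')" "set ws' \<subseteq> int_module.span (set ws)"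
  shows "wedge_norm ws \<le> wedge_norm ws'"
proof -
  define r where "r = length ws"
  have "\<exists>c :: nat \<Rightarrow> real. (\<forall>k. c k \<in> \<int>) \<and> ws' ! j = (\<Sum>k<r. c k *\<^sub>R ws ! k)" if "j < r" for j
  proof -
    have "ws' ! j \<in> int_module.span (set ws)" using that assms(3,6) by (simp add: r_def subset_iff)
    then show ?thesis using int_span_list_coeffs[OF assms(1)] unfolding r_def by metis
  qed
  then obtain A0 :: "nat \<Rightarrow> nat \<Rightarrow> real" where A0: "\<And>j k. j < r \<Longrightarrow> A0 j k \<in> \<int>"
    "\<And>j. j < r \<Longrightarrow> ws' ! j = (\<Sum>k<r. A0 j k *\<^sub>R ws ! k)" by metis
  \<comment> \<open>\<open>det_Ints\<close> asks for integrality at all indices, so the rows from r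
    on are set to zero.\<close>
  define A where "A j k = (if j < r then A0 j k else 0)" for j k
  have AZ: "A j k \<in> \<int>" for j k using A0(1) by (simp add: A_def)
  have A: "ws' ! j = (\<Sum>k<r. A j k *\<^sub>R ws ! k)" if "j < r" for j
    using A0(2)[OF that] that by (simp add: A_def)
  let ?d = "Determinant.det (Matrix.mat r r (\<lambda>(j, k). A j k))"
  have len: "length ws = r" "length ws' = r" using assms(3) by (auto simp: r_def)
  have "?d \<noteq> 0" by (rule independent_imp_det_nonzero[OF len A assms(4,5)])
  moreover have "?d \<in> \<int>" by (rule det_Ints[OF AZ])
  ultimately have d: "1 \<le> \<bar>?d\<bar>" by (rule Ints_nonzero_abs_ge1[rotated])
  obtain "is" where i: "distinct is" "length is = length ws" "wedge_norm ws = \<bar>wedge_coord ws is\<bar>"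
    using wedge_norm_attained[OF independent_list_length[OF assms(1,2)]] by metis
  have "wedge_norm ws \<le> \<bar>?d\<bar> * \<bar>wedge_coord ws is\<bar>"
    using mult_right_mono[OF d, of "\<bar>wedge_coord ws is\<bar>"] i(3) by simp
  also have "\<dots> = \<bar>wedge_coord ws' is\<bar>"
    by (simp add: wedge_coord_transform[OF len A] abs_mult)
  also have "\<dots> \<le> wedge_norm ws'" using i len by (intro wedge_coord_le_norm) auto
  finally show ?thesis .
qed

text \<open>Two bases of one lattice each lie in the integer span of the other, so monotonicity
  applies both ways, and any convenient basis can replace the one picked by
  \<open>SOME\<close>.\<close>

lemma cov_eq:
  fixes \<Delta> :: "(real ^ 'm) set"
  assumes "lattice_basis ws \<Delta>"
  shows "cov \<Delta> = wedge_norm ws"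
proof -
  define us where "us = (SOME ws. lattice_basis ws \<Delta>)"
  have us: "lattice_basis us \<Delta>" unfolding us_def using assms by (rule someI)
  have le: "wedge_norm vs \<le> wedge_norm vs'"
    if vs: "lattice_basis vs \<Delta>" "lattice_basis vs' \<Delta>" for vs vs'
  proof (rule wedge_norm_mono_sublattice)
    show "length vs' = length vs" using vs by (simp add: lattice_basis_length)
    have "int_module.span (set vs) = int_module.span (set vs')"
      using vs unfolding lattice_basis_def by simp
    then show "set vs' \<subseteq> int_module.span (set vs)" by (simp add: int_module.span_superset)
  qed (use vs in \<open>simp_all add: lattice_basis_def\<close>)
  have "wedge_norm us = wedge_norm ws" using le us assms by (blast intro: antisym)
  then show ?thesis by (simp add: cov_def us_def)
qed

text \<open>Laplace expansion along the row of v: up to sign, each of the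
  \<open>Suc (length ws)\<close> cofactors is the coordinate of \<open>ws\<close> at
  \<open>is\<close> with one index deleted.\<close>

lemma wedge_coord_Cons_le:
  fixes ws :: "(real ^ 'm) list"
  assumes "distinct is" "length is = Suc (length ws)"
  shows "\<bar>wedge_coord (v # ws) is\<bar> \<le> real (Suc (length ws)) * (infnorm v * wedge_norm ws)"
proof -
  define r where "r = length ws"
  let ?M = "Matrix.mat (Suc r) (Suc r) (\<lambda>(j, k). (v # ws) ! j $ (is ! k))"
  have cof: "\<bar>cofactor ?M 0 j\<bar> \<le> wedge_norm ws" if j: "j < Suc r" for j
  proof -
    let ?is = "take j is @ drop (Suc j) is"
    have nth: "?is ! k = is ! (if k < j then k else Suc k)" if "k < r" for k
      using that j assms(2) by (auto simp: nth_append r_def min_def)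
    have "mat_delete ?M 0 j = Matrix.mat r r (\<lambda>(j, k). ws ! j $ (?is ! k))"
      by (rule eq_matI) (auto simp: mat_delete_def nth)
    then have "\<bar>cofactor ?M 0 j\<bar> = \<bar>wedge_coord ws ?is\<bar>"
      by (simp add: cofactor_def abs_mult power_abs wedge_coord_det[of ws r] r_def)
    also have "\<dots> \<le> wedge_norm ws"
    proof (rule wedge_coord_le_norm)
      show "distinct ?is" using assms(1) set_take_disj_set_drop_if_distinct[of "is" j "Suc j"] by auto
      show "length ?is = length ws" using j assms(2) by (auto simp: r_def)
    qed
    finally show ?thesis .
  qed
  have "wedge_coord (v # ws) is = (\<Sum>j<Suc r. ?M $$ (0, j) * cofactor ?M 0 j)"
    unfolding wedge_coord_det[of "v # ws" "Suc r", simplified r_def, simplified, folded r_def]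
    by (rule laplace_expansion_row) auto
  then have "\<bar>wedge_coord (v # ws) is\<bar> \<le> (\<Sum>j<Suc r. \<bar>?M $$ (0, j) * cofactor ?M 0 j\<bar>)"
    by (simp only: sum_abs)
  also have "\<dots> \<le> (\<Sum>j<Suc r. infnorm v * wedge_norm ws)"
  proof (rule sum_mono)
    fix j assume "j \<in> {..<Suc r}"
    then show "\<bar>?M $$ (0, j) * cofactor ?M 0 j\<bar> \<le> infnorm v * wedge_norm ws"
      using component_le_infnorm_cart[of v "is ! j"] cof[of j]
      by (auto simp: abs_mult intro!: mult_mono infnorm_pos_le)
  qed
  finally show ?thesis by (simp add: r_def)
qed

lemma wedge_norm_Nil: "wedge_norm ([] :: (real ^ 'm) list) = 1"
proof -
  have "wedge_coord ([] :: (real ^ 'm) list) is = 1" for "is"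
    by (simp add: wedge_coord_def sign_id)
  then show ?thesis by (simp add: wedge_norm_def)
qed

text \<open>
  The matrix expressing \<open>v\<close> and a basis of \<open>\<Delta>\<close> in a basis of \<open>\<Gamma>\<close> is integral and nonsingular, so
  its determinant has modulus at least \<open>1\<close>; expanding along \<open>h v\<close> gives the rest.
\<close>

lemma cov_image_extend:
  fixes h :: "real ^ 'm \<Rightarrow> real ^ 'm"
  fixes \<Delta> \<Gamma> :: "(real ^ 'm) set"
  assumes h: "linear h" "inj h"
    and sub: "int_module.subspace \<Delta>" "int_module.subspace \<Gamma>"
    and prim: "\<Delta> = span \<Delta> \<inter> int_lattice" and lat: "\<Gamma> \<subseteq> int_lattice"
    and v: "v \<in> \<Gamma>" "v \<notin> \<Delta>" and "\<Delta> \<subseteq> \<Gamma>" and dim: "dim \<Gamma> = Suc (dim \<Delta>)"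
  shows "cov (h ` \<Gamma>) \<le> real CARD('m) * (infnorm (h v) * cov (h ` \<Delta>))"
proof -
  obtain ws where ws: "lattice_basis ws \<Delta>"
    using lattice_basis_exists[of \<Delta>] prim sub(1) by blast
  obtain gs where gs: "lattice_basis gs \<Gamma>"
    using lattice_basis_exists[of \<Gamma>] lat sub(2) by blast
  note hws = lattice_basis_image[OF h ws] and hgs = lattice_basis_image[OF h gs]
  have vs: "v \<notin> span (set ws)"
  proof
    assume "v \<in> span (set ws)"
    moreover have "set ws \<subseteq> \<Delta>" using ws int_module.span_superset by (auto simp: lattice_basis_def)
    ultimately show False using v lat prim span_mono[of "set ws" \<Delta>] by blast
  qed
  then have "v \<notin> set ws" using span_base by blast
  have ind: "independent (set (v # ws))"
    using independent_insertI[OF vs] ws by (simp add: lattice_basis_def)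
  have hind: "independent (set (map h (v # ws)))" "distinct (map h (v # ws))"
    using linear_independent_injective_image[OF h(1) ind] inj_on_subset[OF h(2)] ws \<open>v \<notin> set ws\<close>
    by (auto simp: lattice_basis_def distinct_map dest: injD[OF h(2)])
  have len: "length (v # ws) = length gs"
    using lattice_basis_length[OF ws] lattice_basis_length[OF gs] dim by simp
  have hsub: "set (map h (v # ws)) \<subseteq> int_module.span (set (map h gs))"
  proof -
    have "set ws \<subseteq> \<Gamma>" using ws int_module.span_superset \<open>\<Delta> \<subseteq> \<Gamma>\<close> by (auto simp: lattice_basis_def)
    then show ?thesis using v(1) hgs by (auto simp: lattice_basis_def)
  qed
  have "cov (h ` \<Gamma>) = wedge_norm (map h gs)" by (rule cov_eq[OF hgs])
  \<comment> \<open>\<open>v # ws\<close> may generate only a sublattice of finite index, whose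
    covolume is at least that of the full lattice.\<close>
  also have "\<dots> \<le> wedge_norm (map h (v # ws))"
    using hgs hind hsub len by (intro wedge_norm_mono_sublattice) (auto simp: lattice_basis_def)
  also have "\<dots> \<le> real CARD('m) * (infnorm (h v) * wedge_norm (map h ws))"
  proof -
    have l: "length (map h (v # ws)) \<le> CARD('m)" by (rule independent_list_length[OF hind(2,1)])
    obtain "is" where i: "distinct is" "length is = length (map h (v # ws))"
      "wedge_norm (map h (v # ws)) = \<bar>wedge_coord (map h (v # ws)) is\<bar>"
      using wedge_norm_attained[OF l] by metis
    have nn: "0 \<le> wedge_norm (map h ws)"
      using wedge_norm_attained[of "map h ws"] l by (metis abs_ge_zero length_map list.simps(9) Suc_leD length_Cons)
    have "wedge_norm (map h (v # ws)) \<le> real (Suc (length ws)) * (infnorm (h v) * wedge_norm (map h ws))"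
      using wedge_coord_Cons_le[of "is" "map h ws" "h v"] i by simp
    also have "\<dots> \<le> real CARD('m) * (infnorm (h v) * wedge_norm (map h ws))"
      using l nn by (intro mult_right_mono) (auto intro!: mult_nonneg_nonneg infnorm_pos_le)
    finally show ?thesis .
  qed
  finally show ?thesis using cov_eq[OF hws] by simp
qed

section \<open>Short vectors and singular vectors\<close>

lemma primitive_submoduleD:
  assumes "\<Gamma> \<in> primitive_submodules"
  shows "int_module.subspace \<Gamma>" "\<Gamma> \<subseteq> int_lattice" "\<Gamma> = span \<Gamma> \<inter> int_lattice" "0 \<in> \<Gamma>"
  using assms int_module.subspace_0 unfolding primitive_submodules_def by auto

text \<open>A primitive submodule is determined by its real span, so along a chain the rank is
  injective, with values from 1 to the dimension.\<close>

lemma flags_primitive_card: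
  fixes F :: "(real ^ 'm) set set"
  assumes F: "F \<in> flags primitive_submodules"
  shows "card F \<le> CARD('m)"
proof -
  have F': "finite F" "F \<subseteq> primitive_submodules" "\<And>s t. s \<in> F \<Longrightarrow> t \<in> F \<Longrightarrow> s \<subseteq> t \<or> t \<subseteq> s"
    using F by (auto simp: flags_def comparable_def)
  have eq: "a = b"
    if "a \<subseteq> b" "dim a = dim b" "a \<in> primitive_submodules" "b \<in> primitive_submodules"
    for a b :: "(real ^ 'm) set"
  proof -
    have "span a = span b" using dim_eq_span[OF that(1)] that(2) by simp
    then show ?thesis using primitive_submoduleD(3)[OF that(3)] primitive_submoduleD(3)[OF that(4)]
      by simp
  qed
  have "inj_on dim F"
  proof (rule inj_onI)
    fix s t assume st: "s \<in> F" "t \<in> F" "dim s = dim t"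
    then show "s = t" using F'(3)[OF st(1,2)] eq[of s t] eq[of t s] F'(2) by auto
  qed
  then have "card F = card (dim ` F)" by (simp add: card_image)
  also have "\<dots> \<le> card {1..CARD('m)}"
  proof (rule card_mono)
    show "dim ` F \<subseteq> {1..CARD('m)}"
    proof
      fix d assume "d \<in> dim ` F"
      then obtain s :: "(real ^ 'm) set" where s: "s \<in> primitive_submodules" "d = dim s" using F'(2) by blast
      then have "\<not> s \<subseteq> {0}" using primitive_submoduleD(4)[OF s(1)]
        unfolding primitive_submodules_def by auto
      then have "d \<noteq> 0" using s(2) by (simp add: dim_eq_0)
      moreover have "d \<le> CARD('m)" using dim_subset_UNIV[of s] s(2) by simp
      ultimately show "d \<in> {1..CARD('m)}" by simp
    qed
  qed simp
  finally show ?thesis by simp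
qed

text \<open>The empty wedge has norm 1. This serves the case where every member of the flag contains
  the given short vector.\<close>

lemma cov_image_zero:
  fixes h :: "real ^ 'm \<Rightarrow> real ^ 'm"
  assumes "linear h"
  shows "cov (h ` {0}) = 1"
proof -
  have "lattice_basis [] (h ` {0})" using linear_0[OF assms]
    by (simp add: lattice_basis_def independent_empty)
  then show ?thesis using cov_eq wedge_norm_Nil by metis
qed

text \<open>
  Given a nonzero integer vector \<open>v\<close>, let \<open>\<Delta>\<close> be the largest member of the flag (or \<open>{0}\<close>) that
  does not contain \<open>v\<close>. The primitive hull of \<open>\<Delta> + \<int>v\<close> is comparable with the whole flag, hence
  has large covolume, while the covolume of \<open>\<Delta>\<close> is at most \<open>1\<close>.
\<close>

lemma marked_imp_no_short_vector:
  fixes h :: "'a \<Rightarrow> real ^ 'm \<Rightarrow> real ^ 'm"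
  assumes "y \<in> marked \<epsilon> \<rho> (\<lambda>\<Gamma> z. cov (h z ` \<Gamma>)) primitive_submodules"
    and \<rho>: "\<epsilon> \<le> \<rho>" "\<rho> \<le> 1" and h: "linear (h y)" "inj (h y)"
    and v: "v \<in> int_lattice" "v \<noteq> 0"
  shows "\<epsilon> \<le> real CARD('m) * infnorm (h y v)"
proof -
  obtain F where F: "F \<in> flags primitive_submodules"
    and small: "\<forall>s\<in>F. \<epsilon> \<le> cov (h y ` s) \<and> cov (h y ` s) \<le> \<rho>"
    and large: "\<forall>t\<in>primitive_submodules - F. (\<forall>s\<in>F. s \<subseteq> t \<or> t \<subseteq> s) \<longrightarrow> \<rho> \<le> cov (h y ` t)"
    using assms(1) unfolding marked_def comparable_def mem_Collect_eq by (elim bexE conjE)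
  have F': "finite F" "F \<subseteq> primitive_submodules" "\<And>s t. s \<in> F \<Longrightarrow> t \<in> F \<Longrightarrow> s \<subseteq> t \<or> t \<subseteq> s"
    using F by (auto simp: flags_def comparable_def)
  have zero: "0 \<in> s" if "s \<in> F" for s using F'(2) that primitive_submoduleD(4) by blast
  \<comment> \<open>\<open>{0}\<close> keeps the finite chain nonempty, so that its union is its
    largest member.\<close>
  define F0 where "F0 = insert {0} {s \<in> F. v \<notin> s}"
  define \<Delta> where "\<Delta> = \<Union>F0"
  have "\<Delta> \<in> F0" unfolding \<Delta>_def
  proof (rule Union_in_chain)
    show "subset.chain UNIV F0"
      unfolding subset_chain_def F0_def using F'(3) zero by auto
  qed (use F'(1) in \<open>auto simp: F0_def\<close>)
  have v\<Delta>: "v \<notin> \<Delta>" using \<open>\<Delta> \<in> F0\<close> v(2) by (auto simp: F0_def)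
  have prim: "int_module.subspace \<Delta>" "\<Delta> = span \<Delta> \<inter> int_lattice"
  proof -
    have "int_module.subspace {0 :: real ^ 'm}" "{0} = span {0} \<inter> (int_lattice :: (real ^ 'm) set)"
      by (auto simp: int_lattice_def int_module.subspace_def int_scale_def)
    then show "int_module.subspace \<Delta>" "\<Delta> = span \<Delta> \<inter> int_lattice"
      using \<open>\<Delta> \<in> F0\<close> F'(2) primitive_submoduleD(1,3)[of \<Delta>] by (auto simp: F0_def)
  qed
  have cov\<Delta>: "cov (h y ` \<Delta>) \<le> 1"
    using \<open>\<Delta> \<in> F0\<close> small \<rho> cov_image_zero[OF h(1)] by (force simp: F0_def)
  define \<Gamma> where "\<Gamma> = span (insert v \<Delta>) \<inter> int_lattice"
  have ins: "insert v \<Delta> \<subseteq> \<Gamma>" unfolding \<Gamma>_def using v(1) prim(2) by (auto intro: span_base)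
  then have "span \<Gamma> = span (insert v \<Delta>)"
    unfolding \<Gamma>_def by (metis Int_lower1 span_mono span_span subset_antisym)
  then have \<Gamma>: "\<Gamma> = span \<Gamma> \<inter> int_lattice" "dim \<Gamma> = dim (insert v \<Delta>)"
    by (simp add: \<Gamma>_def, metis dim_span)
  have sub: "int_module.subspace \<Gamma>"
    unfolding \<Gamma>_def by (rule int_module.subspaceI)
      (auto simp: int_lattice_def int_scale_def span_add span_scale span_zero)
  have \<Gamma>prim: "\<Gamma> \<in> primitive_submodules"
    using \<Gamma>(1) sub ins v(2) by (auto simp: primitive_submodules_def)
  \<comment> \<open>If s contains v, it contains every member of \<open>F0\<close> and, being
    primitive, the hull \<Gamma>; otherwise s belongs to \<open>F0\<close> and lies inside
    \<Delta>.\<close>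
  have comp: "s \<subseteq> \<Gamma> \<or> \<Gamma> \<subseteq> s" if s: "s \<in> F" for s
  proof (cases "v \<in> s")
    case True
    have "t \<subseteq> s" if "t \<in> F0" for t
      using that F'(3)[OF s, of t] zero[OF s] True by (auto simp: F0_def)
    then have "insert v \<Delta> \<subseteq> s" using True by (auto simp: \<Delta>_def)
    then have "\<Gamma> \<subseteq> span s \<inter> int_lattice" unfolding \<Gamma>_def using span_mono by blast
    then show ?thesis using primitive_submoduleD(3)[of s] F'(2) s by blast
  next
    case False
    then show ?thesis using s ins by (auto simp: \<Delta>_def F0_def)
  qed
  have "\<epsilon> \<le> cov (h y ` \<Gamma>)"
  proof (cases "\<Gamma> \<in> F")
    case True
    then show ?thesis using small by blast
  next
    case False
    then have "\<rho> \<le> cov (h y ` \<Gamma>)" using large \<Gamma>prim comp by blast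
    then show ?thesis using \<rho>(1) by simp
  qed
  also have "\<dots> \<le> real CARD('m) * (infnorm (h y v) * cov (h y ` \<Delta>))"
  proof (rule cov_image_extend[OF h prim(1) sub prim(2)])
    have "v \<notin> span \<Delta>" using v\<Delta> v(1) prim(2) by blast
    then show "dim \<Gamma> = Suc (dim \<Delta>)" using \<Gamma>(2) by (simp add: dim_insert)
  qed (use ins v\<Delta> in \<open>auto simp: \<Gamma>_def\<close>)
  also have "\<dots> \<le> real CARD('m) * (infnorm (h y v) * 1)"
    using cov\<Delta> by (intro mult_left_mono) (auto simp: infnorm_pos_le)
  finally show ?thesis by simp
qed

section \<open>The action of \<open>g_mat k ** u_mat y\<close> and the Dani correspondence\<close>

lemma sum_UNIV_option: "(\<Sum>j\<in>UNIV. F j) = F None + (\<Sum>b\<in>(UNIV :: 'n::finite set). F (Some b))"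
  by (simp add: UNIV_option_conv sum.reindex)

lemma g_u_mult_None:
  fixes y :: "real ^ 'n"
  shows "((g_mat k ** u_mat y) *v v) $ None =
    exp (real CARD('n) * real k) * (v $ None + (\<Sum>b\<in>UNIV. y $ b * v $ Some b))"
  by (simp add: matrix_vector_mul_assoc[symmetric])
    (simp add: matrix_vector_mult_def g_mat_def u_mat_def sum_UNIV_option)

lemma g_u_mult_Some:
  fixes y :: "real ^ 'n"
  shows "((g_mat k ** u_mat y) *v v) $ Some a = exp (- real k) * v $ Some a"
  by (simp add: matrix_vector_mul_assoc[symmetric])
    (simp add: matrix_vector_mult_def g_mat_def u_mat_def sum_UNIV_option if_distrib if_distribR cong: if_cong)

lemma inj_g_u: "inj ((*v) (g_mat k ** u_mat y))"
proof (rule injI)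
  fix v w assume eq: "(g_mat k ** u_mat y) *v v = (g_mat k ** u_mat y) *v w"
  have S: "v $ Some a = w $ Some a" for a
    using arg_cong[OF eq, of "\<lambda>z. z $ Some a"] by (simp add: g_u_mult_Some)
  then have "v $ None = w $ None"
    using arg_cong[OF eq, of "\<lambda>z. z $ None"] by (simp add: g_u_mult_None)
  then have "v $ i = w $ i" for i using S by (cases i) auto
  then show "v = w" by (simp add: Finite_Cartesian_Product.vec_eq_iff)
qed

lemma cov_image_nonneg:
  fixes h :: "real ^ 'm \<Rightarrow> real ^ 'm"
  assumes "linear h" "inj h" "\<Gamma> \<in> primitive_submodules"
  shows "0 \<le> cov (h ` \<Gamma>)"
proof -
  obtain ws where "lattice_basis ws \<Gamma>"
    using lattice_basis_exists primitive_submoduleD[OF assms(3)] by metis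
  note b = lattice_basis_image[OF assms(1,2) this]
  then have "length (map h ws) \<le> CARD('m)"
    by (intro independent_list_length) (auto simp: lattice_basis_def)
  then obtain "is" where "wedge_norm (map h ws) = \<bar>wedge_coord (map h ws) is\<bar>"
    by (rule wedge_norm_attained)
  then show ?thesis using cov_eq[OF b] by simp
qed

text \<open>One integral basis of \<Gamma> serves all z, so the covolume is a maximum of finitely
  many absolute values of minors, each continuous on V.\<close>

lemma open_cov_sublevel:
  fixes H :: "'a::topological_space \<Rightarrow> real ^ 'm ^ 'm"
  assumes "open V" and cont: "\<And>i j. continuous_on V (\<lambda>z. H z $ i $ j)"
    and inj: "\<And>z. inj ((*v) (H z))" and \<Gamma>: "\<Gamma> \<in> primitive_submodules"
  shows "open {z \<in> V. cov ((*v) (H z) ` \<Gamma>) < e}"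
proof -
  obtain ws where ws: "lattice_basis ws \<Gamma>"
    using lattice_basis_exists primitive_submoduleD[OF \<Gamma>] by metis
  define J :: "'m list set" where "J = {is. distinct is \<and> length is = length ws}"
  define g where "g is z = \<bar>wedge_coord (map ((*v) (H z)) ws) is\<bar>" for "is" z
  have "finite {is :: 'm list. set is \<subseteq> UNIV \<and> length is = length ws}"
    by (rule finite_lists_length_eq) simp
  then have J: "finite J" by (rule finite_subset[rotated]) (auto simp: J_def)
  have "length ws \<le> CARD('m)"
    using ws by (intro independent_list_length) (auto simp: lattice_basis_def)
  then have J0: "J \<noteq> {}" unfolding J_def using exists_distinct_index_list by blast
  have "cov ((*v) (H z) ` \<Gamma>) = Max ((\<lambda>is. g is z) ` J)" for z
    using cov_eq[OF lattice_basis_image[OF matrix_vector_mul_linear inj ws], of z]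
    by (simp add: wedge_norm_def g_def J_def setcompr_eq_image)
  then have "{z \<in> V. cov ((*v) (H z) ` \<Gamma>) < e} = (\<Inter>is\<in>J. g is -` {..<e} \<inter> V)"
    using J J0 by auto
  moreover have "open (g is -` {..<e} \<inter> V)" for "is"
  proof -
    have "continuous_on V (g is)"
      unfolding g_def wedge_coord_def length_map
    proof (intro continuous_on_rabs continuous_on_sum continuous_on_mult_left continuous_on_prod)
      fix p j assume "j \<in> {..<length ws}"
      then have "(\<lambda>z. map ((*v) (H z)) ws ! j $ (is ! p j)) =
          (\<lambda>z. \<Sum>l\<in>UNIV. H z $ (is ! p j) $ l * ws ! j $ l)"
        by (simp add: matrix_vector_mult_def)
      then show "continuous_on V (\<lambda>z. map ((*v) (H z)) ws ! j $ (is ! p j))"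
        by (simp only:) (intro continuous_on_sum continuous_on_mult_right cont)
    qed
    then have "\<forall>S. open S \<longrightarrow> open (g is -` S \<inter> V)"
      by (simp only: continuous_on_open_vimage[OF \<open>open V\<close>])
    then show ?thesis by simp
  qed
  moreover from this have "open (\<Inter>is\<in>J. g is -` {..<e} \<inter> V)" by (intro open_INT ballI J)
  ultimately show ?thesis by simp
qed

lemma continuous_on_g_u:
  fixes f :: "'a::topological_space \<Rightarrow> real ^ 'n"
  assumes "continuous_on V f"
  shows "continuous_on V (\<lambda>z. (g_mat k ** u_mat (f z)) $ i $ j)"
proof -
  have "continuous_on V (\<lambda>z. u_mat (f z) $ l $ j)" for l
    by (cases l; cases j) (auto simp: u_mat_def intro!: continuous_intros assms)
  then show ?thesis
    unfolding matrix_matrix_mult_def by simp (intro continuous_on_sum continuous_on_mult_left)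
qed

lemma infnorm_le_cart:
  fixes v :: "real ^ 'm"
  assumes "\<And>i. \<bar>v $ i\<bar> \<le> d"
  shows "infnorm v \<le> d"
  unfolding infnorm_cart by (rule cSup_least) (use assms in auto)

text \<open>With Q = d e^k and c = d^(n+1), the coordinate \<open>None\<close> is bounded by e^(nk)
  c / Q^n = d and every other one by e^(-k) Q = d.\<close>

lemma singular_vector_imp_short_vectors:
  fixes y :: "real ^ 'n"
  assumes "singular_vector y" "\<delta> > 0"
  shows "\<forall>\<^sub>F k in sequentially. \<exists>v\<in>int_lattice. v \<noteq> 0 \<and> infnorm ((g_mat k ** u_mat y) *v v) < \<delta>"
proof -
  define n where "n = CARD('n)"
  \<comment> \<open>Half of \<delta>, because the bound on \<open>infnorm q\<close> is not
    strict.\<close>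
  define d where "d = \<delta> / 2"
  have d: "0 < d" "d < \<delta>" using assms(2) by (auto simp: d_def)
  have "\<forall>\<^sub>F Q in at_top. \<exists>q\<in>int_lattice. \<exists>q0 :: int. q \<noteq> 0 \<and>
      \<bar>q \<bullet> y + of_int q0\<bar> < d ^ Suc n / Q ^ n \<and> infnorm q \<le> Q"
    using assms(1) d(1) unfolding singular_vector_def n_def by simp
  moreover have "filterlim (\<lambda>k. d * exp (real k)) at_top sequentially"
    by (intro filterlim_tendsto_pos_mult_at_top[OF tendsto_const d(1)]
        filterlim_compose[OF exp_at_top filterlim_real_sequentially])
  ultimately have "\<forall>\<^sub>F k in sequentially. \<exists>q\<in>int_lattice. \<exists>q0 :: int. q \<noteq> 0 \<and>
      \<bar>q \<bullet> y + of_int q0\<bar> < d ^ Suc n / (d * exp (real k)) ^ n \<and> infnorm q \<le> d * exp (real k)"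
    by (rule eventually_compose_filterlim)
  then show ?thesis
  proof eventually_elim
    case (elim k)
    then obtain q and q0 :: int where q: "q \<in> int_lattice" "q \<noteq> 0"
      "\<bar>q \<bullet> y + of_int q0\<bar> < d ^ Suc n / (d * exp (real k)) ^ n" "infnorm q \<le> d * exp (real k)"
      by blast
    define v :: "real ^ ('n option)"
      where "v = (\<chi> j. case j of None \<Rightarrow> of_int q0 | Some b \<Rightarrow> q $ b)"
    have "v \<in> int_lattice" using q(1) by (auto simp: int_lattice_def v_def split: option.split)
    moreover have "v \<noteq> 0"
    proof
      assume "v = 0"
      then have "v $ Some b = 0" for b by simp
      then have "q $ b = 0" for b by (simp add: v_def)
      with q(2) show False by (simp add: Finite_Cartesian_Product.vec_eq_iff)
    qed
    moreover have "infnorm ((g_mat k ** u_mat y) *v v) \<le> d"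
    proof (rule infnorm_le_cart)
      fix i
      show "\<bar>((g_mat k ** u_mat y) *v v) $ i\<bar> \<le> d"
      proof (cases i)
        case None
        have "((g_mat k ** u_mat y) *v v) $ None = exp (real k) ^ n * (q \<bullet> y + of_int q0)"
          by (simp add: g_u_mult_None v_def inner_vec_def n_def mult.commute exp_of_nat_mult[symmetric])
        then have "\<bar>((g_mat k ** u_mat y) *v v) $ None\<bar> = exp (real k) ^ n * \<bar>q \<bullet> y + of_int q0\<bar>"
          by (simp add: abs_mult)
        also have "\<dots> \<le> exp (real k) ^ n * (d ^ Suc n / (d * exp (real k)) ^ n)"
          using q(3) by (intro mult_left_mono) auto
        also have "\<dots> = d" using d(1) by (simp add: power_mult_distrib)
        finally show ?thesis by (simp add: None)
      next
        case (Some a)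
        have "\<bar>q $ a\<bar> \<le> d * exp (real k)" using component_le_infnorm_cart[of q a] q(4) by linarith
        then have "exp (- real k) * \<bar>q $ a\<bar> \<le> exp (- real k) * (d * exp (real k))"
          by (intro mult_left_mono) auto
        also have "\<dots> = d" by (simp add: exp_minus)
        finally show ?thesis by (simp add: Some g_u_mult_Some v_def abs_mult)
      qed
    qed
    ultimately show ?case using d(2) by (metis le_less_trans)
  qed
qed

text \<open>Membership in \<open>null_sets\<close> includes measurability. The quantifiers over real
  c and Q are reduced to c = 1/(j+1) and integral Q, which leaves a countable combination of open
  sets.\<close>

lemma singular_vectors_borel: "{y :: real ^ 'n. singular_vector y} \<in> sets borel"
proof -
  define n where "n = CARD('n)"
  define W where "W c m = (\<Union>q\<in>{q \<in> int_lattice. q \<noteq> 0 \<and> infnorm q \<le> m}. \<Union>q0 :: int.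
      {y :: real ^ 'n. \<bar>q \<bullet> y + of_int q0\<bar> < c / m ^ n})" for c m :: real
  have W: "open (W c m)" for c m
    unfolding W_def by (intro open_UN ballI open_Collect_less continuous_intros)
  have sing: "singular_vector y \<longleftrightarrow> (\<forall>c>0. \<forall>\<^sub>F Q in at_top. y \<in> W c Q)" for y
  proof -
    have "y \<in> W c Q \<longleftrightarrow> (\<exists>q\<in>int_lattice. \<exists>q0 :: int. q \<noteq> 0 \<and>
        \<bar>q \<bullet> y + of_int q0\<bar> < c / Q ^ n \<and> infnorm q \<le> Q)" for c Q
      by (auto simp: W_def)
    then show ?thesis unfolding singular_vector_def n_def by simp
  qed
  have sing_nat: "singular_vector y \<longleftrightarrow> (\<forall>j :: nat. \<exists>M. \<forall>m\<ge>M. y \<in> W (1 / Suc j) (real m))" for y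
  proof (intro iffI allI)
    fix j assume "singular_vector y"
    then have "\<forall>\<^sub>F Q in at_top. y \<in> W (1 / Suc j) Q" by (simp add: sing)
    then have "\<forall>\<^sub>F m in sequentially. y \<in> W (1 / Suc j) (real m)"
      using filterlim_real_sequentially by (rule eventually_compose_filterlim)
    then show "\<exists>M. \<forall>m\<ge>M. y \<in> W (1 / Suc j) (real m)" by (simp add: eventually_sequentially)
  next
    assume R: "\<forall>j :: nat. \<exists>M. \<forall>m\<ge>M. y \<in> W (1 / Suc j) (real m)"
    show "singular_vector y"
      unfolding sing
    proof (intro allI impI)
      fix c :: real assume c: "c > 0"
      \<comment> \<open>The factor 2^n absorbs the passage from Q to its integer part m, for which Q
        \<le> 2 m.\<close>
      obtain j where "inverse (real (Suc j)) < c / 2 ^ n"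
        using reals_Archimedean[of "c / 2 ^ n"] c by auto
      then have j: "1 / Suc j * 2 ^ n \<le> c" by (simp add: field_simps)
      obtain M where M: "\<And>m. m \<ge> M \<Longrightarrow> y \<in> W (1 / Suc j) (real m)" using R by blast
      show "\<forall>\<^sub>F Q in at_top. y \<in> W c Q"
      proof (rule eventually_mono[OF eventually_ge_at_top[of "real M + 1"]])
        fix Q :: real assume Q: "real M + 1 \<le> Q"
        define m where "m = nat \<lfloor>Q\<rfloor>"
        have fl: "int M + 1 \<le> \<lfloor>Q\<rfloor>" using Q by linarith
        then have "real m = of_int \<lfloor>Q\<rfloor>" by (simp add: m_def)
        then have m: "M \<le> m" "1 \<le> m" "real m \<le> Q" "Q \<le> 2 * real m"
          using fl by linarith+
        have "y \<in> W (1 / Suc j) (real m)" using M m(1) by blast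
        then obtain q and q0 :: int where q: "q \<in> int_lattice" "q \<noteq> 0" "infnorm q \<le> m"
          "\<bar>q \<bullet> y + of_int q0\<bar> < 1 / Suc j / real m ^ n" by (auto simp: W_def)
        have "1 / Suc j / real m ^ n = (1 / Suc j * 2 ^ n) / (2 * real m) ^ n"
          using m(2) by (simp add: power_mult_distrib)
        also have "\<dots> \<le> c / (2 * real m) ^ n" using j by (intro divide_right_mono) auto
        also have "\<dots> \<le> c / Q ^ n"
          using c m Q by (intro divide_left_mono power_mono mult_pos_pos zero_less_power) auto
        finally have "\<bar>q \<bullet> y + of_int q0\<bar> < c / Q ^ n" using q(4) by linarith
        then show "y \<in> W c Q" using q m(3) by (force simp: W_def)
      qed
    qed
  qed
  have "{y. singular_vector y} = (\<Inter>j :: nat. \<Union>M. \<Inter>m\<in>{M..}. W (1 / Suc j) (real m))"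
    by (intro Set.set_eqI) (simp add: sing_nat del: of_nat_Suc, simp add: Ball_def)
  also have "\<dots> \<in> sets borel"
    by (intro sets.countable_INT' sets.countable_UN' ballI) (auto intro: borel_open W)
  finally show ?thesis .
qed

section \<open>Localization\<close>

text \<open>The supremum in the definition of goodness is replaced by a lower bound \<rho> found at
  one support point. The comparison of quotients is made in \<open>ennreal\<close> because the
  supremum may be infinite.\<close>

lemma good_on_emeasure_le:
  assumes good: "good_on C \<alpha> \<mu> V h" and C: "0 \<le> C" "0 < \<alpha>" and "0 < \<epsilon>" "0 < \<rho>"
    and z: "z \<in> msupp \<mu>" "0 < t" "ball z t \<subseteq> V"
    and y: "y \<in> ball z t \<inter> msupp \<mu>" "\<rho> \<le> h y"
    and nn: "\<And>y. 0 \<le> h y"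
  shows "emeasure \<mu> {y \<in> ball z t. h y < \<epsilon>} \<le>
    ennreal (C * (\<epsilon> / \<rho>) powr \<alpha>) * emeasure \<mu> (ball z t)"
proof -
  define s where "s = (SUP y \<in> ball z t \<inter> msupp \<mu>. ennreal \<bar>h y\<bar>)"
  have "ennreal \<rho> \<le> ennreal \<bar>h y\<bar>" using y(2) by (intro ennreal_leI) simp
  also have "\<dots> \<le> s" unfolding s_def using y(1) by (rule SUP_upper)
  finally have s: "ennreal \<rho> \<le> s" .
  then have "0 < s" using \<open>0 < \<rho>\<close> by (meson ennreal_less_zero_iff less_le_trans)
  moreover have "ennreal \<epsilon> \<le> s * ennreal (\<epsilon> / \<rho>)"
  proof -
    have "ennreal \<epsilon> = ennreal \<rho> * ennreal (\<epsilon> / \<rho>)"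
      using \<open>0 < \<epsilon>\<close> \<open>0 < \<rho>\<close> by (simp add: ennreal_mult[symmetric])
    also have "\<dots> \<le> s * ennreal (\<epsilon> / \<rho>)" using s by (rule mult_right_mono) simp
    finally show ?thesis .
  qed
  ultimately have q: "ennreal \<epsilon> / s \<le> ennreal (\<epsilon> / \<rho>)" by (rule divide_le_posI_ennreal)
  then have "enn2real (ennreal \<epsilon> / s) \<le> \<epsilon> / \<rho>"
    using enn2real_mono[OF q] \<open>0 < \<epsilon>\<close> \<open>0 < \<rho>\<close> by simp
  then have "ennreal_powr (ennreal \<epsilon> / s) \<alpha> \<le> ennreal ((\<epsilon> / \<rho>) powr \<alpha>)"
    using q C(2) by (auto simp: ennreal_powr_def top_unique intro!: ennreal_leI powr_mono2)
  then have "ennreal C * ennreal_powr (ennreal \<epsilon> / s) \<alpha> \<le> ennreal (C * (\<epsilon> / \<rho>) powr \<alpha>)"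
    using C(1) by (simp add: ennreal_mult mult_left_mono)
  then have "ennreal C * ennreal_powr (ennreal \<epsilon> / s) \<alpha> * emeasure \<mu> (ball z t)
      \<le> ennreal (C * (\<epsilon> / \<rho>) powr \<alpha>) * emeasure \<mu> (ball z t)"
    by (rule mult_right_mono) simp
  moreover have "emeasure \<mu> {y \<in> ball z t. h y < \<epsilon>}
      \<le> ennreal C * ennreal_powr (ennreal \<epsilon> / s) \<alpha> * emeasure \<mu> (ball z t)"
    using good z \<open>0 < \<epsilon>\<close> nn unfolding good_on_def s_def by simp
  ultimately show ?thesis by (rule order_trans[rotated])
qed

lemma good_on_subset: "good_on C \<alpha> \<mu> V h \<Longrightarrow> W \<subseteq> V \<Longrightarrow> good_on C \<alpha> \<mu> W h"
  unfolding good_on_def by (meson order_trans)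

text \<open>
  If \<open>h < \<rho>'\<close> on the whole smaller ball, that ball lies in a sublevel set whose mass goodness makes
  too small. Since \<open>\<rho>'\<close> depends only on the masses of the two balls, it serves all \<open>h\<close> at once;
  this carries hypothesis (2) over to small balls, on which the doubling constant is uniform.
\<close>

lemma good_on_large_on_small_ball:
  fixes \<mu> :: "'a::metric_space measure"
  assumes sets: "sets \<mu> = sets borel" and C: "0 < C" "0 < \<alpha>" and "0 < \<rho>"
    and z: "z \<in> msupp \<mu>" "ball z t \<subseteq> V" "0 < t'" "t' \<le> t"
    and null: "ball z t' - msupp \<mu> \<in> null_sets \<mu>" and fin: "emeasure \<mu> (ball z t) < \<infinity>"
  obtains \<rho>' where "0 < \<rho>'" "\<rho>' \<le> 1"
    "\<And>h. good_on C \<alpha> \<mu> V h \<Longrightarrow> (\<And>y. 0 \<le> h y) \<Longrightarrow> (\<And>e. open {y \<in> V. h y < e}) \<Longrightarrow>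
      \<exists>y\<in>ball z t \<inter> msupp \<mu>. \<rho> \<le> h y \<Longrightarrow> \<exists>y\<in>ball z t' \<inter> msupp \<mu>. \<rho>' \<le> h y"
proof -
  have sub: "ball z t' \<subseteq> ball z t" using z(4) by (rule subset_ball)
  have pos: "0 < emeasure \<mu> (ball z t')" using z(1,3) by (auto simp: msupp_def)
  have le: "emeasure \<mu> (ball z t') \<le> emeasure \<mu> (ball z t)"
    using sub by (intro emeasure_mono) (auto simp: sets)
  obtain m where m: "emeasure \<mu> (ball z t) = ennreal m" "0 \<le> m"
    using fin by (cases "emeasure \<mu> (ball z t)") auto
  obtain m' where m': "emeasure \<mu> (ball z t') = ennreal m'" "0 \<le> m'"
    using fin le by (cases "emeasure \<mu> (ball z t')") auto
  have "0 < m'" using pos m' by simp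
  \<comment> \<open>Chosen so that \<open>C * a * m\<close> is strictly below
    \<open>m'\<close>.\<close>
  define a where "a = m' / (2 * C * (m + 1))"
  have a: "0 < a" using \<open>0 < m'\<close> m(2) C by (simp add: a_def)
  \<comment> \<open>The exponent 1 / \<alpha> cancels the exponent of goodness; the cap at 1 is what
    the argument on marked points asks of its threshold.\<close>
  define \<rho>' where "\<rho>' = min 1 (\<rho> * a powr (1 / \<alpha>))"
  have \<rho>': "0 < \<rho>'" "\<rho>' \<le> 1" using a \<open>0 < \<rho>\<close> by (auto simp: \<rho>'_def)
  have "\<rho>' / \<rho> \<le> a powr (1 / \<alpha>)" using \<open>0 < \<rho>\<close> by (simp add: \<rho>'_def field_simps)
  then have "(\<rho>' / \<rho>) powr \<alpha> \<le> (a powr (1 / \<alpha>)) powr \<alpha>"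
    using \<rho>' \<open>0 < \<rho>\<close> C by (intro powr_mono2) auto
  also have "\<dots> = a" using a C by (simp add: powr_powr)
  finally have "C * (\<rho>' / \<rho>) powr \<alpha> * m \<le> C * a * m" using C m(2) by (intro mult_right_mono mult_left_mono) auto
  also have "C * a = m' / (2 * (m + 1))" using C by (simp add: a_def)
  also have "m' / (2 * (m + 1)) * m = m' * (m / (2 * (m + 1)))" by simp
  also have "\<dots> < m' * 1" using \<open>0 < m'\<close> m(2) by (intro mult_strict_left_mono) (auto simp: field_simps)
  finally have small: "C * (\<rho>' / \<rho>) powr \<alpha> * m < m'" by simp
  show thesis
  proof (rule that[OF \<rho>'])
    fix h assume h: "good_on C \<alpha> \<mu> V h" "\<And>y. 0 \<le> h y" "\<And>e. open {y \<in> V. h y < e}"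
      "\<exists>y\<in>ball z t \<inter> msupp \<mu>. \<rho> \<le> h y"
    show "\<exists>y\<in>ball z t' \<inter> msupp \<mu>. \<rho>' \<le> h y"
    proof (rule ccontr)
      assume neg: "\<not> (\<exists>y\<in>ball z t' \<inter> msupp \<mu>. \<rho>' \<le> h y)"
      let ?T = "{y \<in> ball z t. h y < \<rho>'}"
      have "?T = ball z t \<inter> {y \<in> V. h y < \<rho>'}" using z(2) by auto
      then have T: "?T \<in> sets \<mu>" using h(3)[of \<rho>'] by (simp add: sets borel_open)
      have "emeasure \<mu> (ball z t') \<le> emeasure \<mu> (?T \<union> (ball z t' - msupp \<mu>))"
        using neg sub T null by (intro emeasure_mono) (auto simp: not_le null_setsD2)
      also have "\<dots> = emeasure \<mu> ?T" using T null by (rule emeasure_Un_null_set)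
      also have "\<dots> \<le> ennreal (C * (\<rho>' / \<rho>) powr \<alpha>) * emeasure \<mu> (ball z t)"
      proof -
        obtain y where "y \<in> ball z t \<inter> msupp \<mu>" "\<rho> \<le> h y" using h(4) by blast
        then show ?thesis
          by (intro good_on_emeasure_le[OF h(1)]) (use C z \<rho>' \<open>0 < \<rho>\<close> h(2) in auto)
      qed
      also have "\<dots> = ennreal (C * (\<rho>' / \<rho>) powr \<alpha> * m)"
        using C m by (simp add: ennreal_mult)
      also have "\<dots> < ennreal m'" using small m(2) C \<open>0 < m'\<close> by (intro ennreal_lessI) auto
      finally show False using m'(1) by simp
    qed
  qed
qed

lemma singular_preimage_sets:
  fixes f :: "'a::metric_space \<Rightarrow> real ^ 'n"
  assumes "continuous_on W f" "open W"
  shows "{z \<in> W. singular_vector (f z)} \<in> sets borel"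
proof -
  have "f -` {y. singular_vector y} \<inter> space (restrict_space borel W) \<in> sets (restrict_space borel W)"
    using borel_measurable_continuous_on_restrict[OF assms(1)] singular_vectors_borel
    by (rule measurable_sets)
  then have "f -` {y. singular_vector y} \<inter> W \<in> sets borel"
    using assms(2) by (simp add: sets_restrict_space_iff space_restrict_space)
  moreover have "f -` {y. singular_vector y} \<inter> W = {z \<in> W. singular_vector (f z)}" by auto
  ultimately show ?thesis by simp
qed

text \<open>T lies in the lower limit of the sets \<open>E i\<close>, an increasing union of tail
  intersections each of mass at most b.\<close>

lemma emeasure_eventually_le:
  assumes "T \<in> sets \<mu>" "\<And>i. E i \<in> sets \<mu>" "\<And>i. emeasure \<mu> (E i) \<le> b"
    and ev: "\<And>z. z \<in> T \<Longrightarrow> \<forall>\<^sub>F i in sequentially. z \<in> E i"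
  shows "emeasure \<mu> T \<le> b"
proof -
  define G where "G m = (\<Inter>i\<in>{m..}. E i)" for m :: nat
  have G: "G m \<in> sets \<mu>" for m unfolding G_def using assms(2) by (intro sets.countable_INT') auto
  have "T \<subseteq> (\<Union>m. G m)" using ev by (fastforce simp: G_def eventually_sequentially)
  then have "emeasure \<mu> T \<le> emeasure \<mu> (\<Union>m. G m)" using G by (intro emeasure_mono) auto
  also have "\<dots> = (SUP m. emeasure \<mu> (G m))"
    using G by (intro SUP_emeasure_incseq[symmetric]) (auto simp: incseq_def G_def)
  also have "\<dots> \<le> b"
  proof (rule SUP_least)
    fix m
    have "emeasure \<mu> (G m) \<le> emeasure \<mu> (E m)" using assms(2) by (intro emeasure_mono) (auto simp: G_def)
    then show "emeasure \<mu> (G m) \<le> b" using assms(3) order_trans by blast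
  qed
  finally show ?thesis .
qed

text \<open>Flags have at most n + 1 members, whence the radius factor 7^(n+1). The constant
  \<open>M'\<close> is fixed before \<epsilon> and i.\<close>

lemma singular_null_in_small_ball:
  fixes \<mu> :: "'a::metric_space measure" and f :: "'a \<Rightarrow> real ^ 'n"
  defines "\<psi> \<equiv> \<lambda>k \<Gamma> z. cov ((*v) (g_mat k ** u_mat (f z)) ` \<Gamma>)"
  assumes bes: "besicovitch_space TYPE('a)" and sets: "sets \<mu> = sets borel"
    and V: "open V" "bounded V" "emeasure \<mu> V < \<infinity>" "continuous_on V f"
    and D: "D < \<infinity>" "\<And>y t. y \<in> msupp \<mu> \<Longrightarrow> t > 0 \<Longrightarrow> ball y (3 * t) \<subseteq> V \<Longrightarrow>
       emeasure \<mu> (ball y (3 * t)) \<le> D * emeasure \<mu> (ball y t)"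
    and C: "0 < C" "0 < \<alpha>" "\<And>k \<Gamma>. \<Gamma> \<in> primitive_submodules \<Longrightarrow> good_on C \<alpha> \<mu> V (\<psi> k \<Gamma>)"
    and x: "x \<in> msupp \<mu>" "0 < r" "ball x (7 ^ (CARD('n) + 1) * r) \<subseteq> V"
    and \<rho>: "0 < \<rho>" "\<rho> \<le> 1" and k: "filterlim k at_top sequentially"
    and large: "\<And>i \<Gamma>. \<Gamma> \<in> primitive_submodules \<Longrightarrow> \<exists>y\<in>ball x r \<inter> msupp \<mu>. \<rho> \<le> \<psi> (k i) \<Gamma> y"
  shows "{z \<in> ball x r. singular_vector (f z)} \<in> null_sets \<mu>"
proof -
  define T where "T = {z \<in> ball x r. singular_vector (f z)}"
  have "(1::real) \<le> 7 ^ (CARD('n) + 1)" by (rule one_le_power) simp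
  then have "ball x r \<subseteq> V" using x subset_ball[of r "7 ^ (CARD('n) + 1) * r" x] by auto
  then have T: "T \<in> sets \<mu>" unfolding T_def sets
    using V(4) by (intro singular_preimage_sets) (auto intro: continuous_on_subset)
  have nn: "0 \<le> \<psi> i \<Gamma> z" if "\<Gamma> \<in> primitive_submodules" for i \<Gamma> z
    unfolding \<psi>_def by (rule cov_image_nonneg[OF matrix_vector_mul_linear inj_g_u that])
  have usc: "open {z \<in> V. \<psi> i \<Gamma> z < e}" if "\<Gamma> \<in> primitive_submodules" for i \<Gamma> e
    unfolding \<psi>_def by (rule open_cov_sublevel[OF V(1) continuous_on_g_u[OF V(4)] inj_g_u that])
  obtain N :: nat where N: "\<And>(A::'a set) R. bounded A \<Longrightarrow> (\<And>z. z \<in> A \<Longrightarrow> R z > 0) \<Longrightarrow>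
       besicovitch_subcover N A R"
    by (rule besicovitch_cover[OF bes]) blast
  define M where "M = nondiv_const N D (CARD('n) + 1) * emeasure \<mu> (ball x r)"
  have "emeasure \<mu> (ball x r) < \<infinity>"
    using emeasure_mono[OF \<open>ball x r \<subseteq> V\<close>, of \<mu>] V(1,3) by (auto simp: sets borel_open)
  then have "M < \<infinity>" unfolding M_def using nondiv_const_finite[OF D(1), of N "CARD('n) + 1"]
    by (simp add: ennreal_mult_less_top)
  then obtain M' where M': "M = ennreal M'" "0 \<le> M'" by (cases M) auto
  have bound: "emeasure \<mu> T \<le> ennreal (C * (\<epsilon> / \<rho>) powr \<alpha> * M')" if \<epsilon>: "0 < \<epsilon>" "\<epsilon> \<le> \<rho>" for \<epsilon>
  proof -
    define \<kappa> where "\<kappa> = ennreal (C * (\<epsilon> / \<rho>) powr \<alpha>)"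
    have "\<exists>E\<in>sets \<mu>. ball x r \<subseteq> marked \<epsilon> \<rho> (\<psi> (k i)) primitive_submodules \<union> E \<and>
       emeasure \<mu> E \<le> nondiv_const N D (CARD('n) + 1) * \<kappa> * emeasure \<mu> (ball x r)" for i
    proof (rule quantitative_nondivergence[OF sets null_diff_msupp[OF bes sets V(2,1)] N D(2)])
      show "card F \<le> CARD('n) + 1" if "F \<in> flags (primitive_submodules :: (real ^ 'n option) set set)" for F
        using flags_primitive_card[OF that] by simp
      show "emeasure \<mu> {y \<in> ball z t. \<psi> (k i) \<Gamma> y < \<epsilon>} \<le> \<kappa> * emeasure \<mu> (ball z t)"
        if asm: "\<Gamma> \<in> primitive_submodules" "z \<in> msupp \<mu>" "t > 0" "ball z t \<subseteq> V"
          "\<exists>y\<in>ball z t \<inter> msupp \<mu>. \<rho> \<le> \<psi> (k i) \<Gamma> y" for \<Gamma> z t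
      proof -
        obtain y where "y \<in> ball z t \<inter> msupp \<mu>" "\<rho> \<le> \<psi> (k i) \<Gamma> y" using asm(5) by blast
        then show ?thesis unfolding \<kappa>_def
          by (intro good_on_emeasure_le[OF C(3)]) (use asm C(1,2) \<epsilon> \<rho> nn in auto)
      qed
    qed (use usc x large in auto)
    then obtain E where E: "\<And>i. E i \<in> sets \<mu>"
      "\<And>i. ball x r \<subseteq> marked \<epsilon> \<rho> (\<psi> (k i)) primitive_submodules \<union> E i"
      "\<And>i. emeasure \<mu> (E i) \<le> nondiv_const N D (CARD('n) + 1) * \<kappa> * emeasure \<mu> (ball x r)"
      by metis
    have "emeasure \<mu> T \<le> nondiv_const N D (CARD('n) + 1) * \<kappa> * emeasure \<mu> (ball x r)"
    proof (rule emeasure_eventually_le[OF T E(1,3)])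
      fix z assume z: "z \<in> T"
      \<comment> \<open>The denominator cancels the dimension factor produced by the Laplace
        expansion.\<close>
      define \<delta> where "\<delta> = \<epsilon> / real CARD('n option)"
      have \<delta>: "0 < \<delta>" using \<epsilon>(1) by (simp add: \<delta>_def)
      have "\<forall>\<^sub>F i in sequentially. \<exists>v\<in>int_lattice. v \<noteq> 0 \<and>
          infnorm ((g_mat (k i) ** u_mat (f z)) *v v) < \<delta>"
        using singular_vector_imp_short_vectors[OF _ \<delta>] z
        by (intro eventually_compose_filterlim[OF _ k]) (auto simp: T_def)
      then show "\<forall>\<^sub>F i in sequentially. z \<in> E i"
      proof eventually_elim
        case (elim i)
        then obtain v :: "real ^ 'n option" where v: "v \<in> int_lattice" "v \<noteq> 0"
          "infnorm ((g_mat (k i) ** u_mat (f z)) *v v) < \<delta>" by blast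
        have "z \<notin> marked \<epsilon> \<rho> (\<psi> (k i)) primitive_submodules"
        proof
          assume "z \<in> marked \<epsilon> \<rho> (\<psi> (k i)) primitive_submodules"
          then have "\<epsilon> \<le> real CARD('n option) * infnorm ((g_mat (k i) ** u_mat (f z)) *v v)"
            unfolding \<psi>_def
            by (rule marked_imp_no_short_vector[where h = "\<lambda>z. (*v) (g_mat (k i) ** u_mat (f z))"])
              (use \<epsilon> \<rho> v inj_g_u in auto)
          then have "\<delta> \<le> infnorm ((g_mat (k i) ** u_mat (f z)) *v v)"
            by (simp add: \<delta>_def field_simps del: card_option)
          with v(3) show False by simp
        qed
        then show ?case using E(2)[of i] z by (auto simp: T_def)
      qed
    qed
    also have "\<dots> = \<kappa> * M" by (simp add: M_def mult_ac)
    also have "\<dots> = ennreal (C * (\<epsilon> / \<rho>) powr \<alpha> * M')"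
      using C(1) M' by (simp add: \<kappa>_def ennreal_mult)
    finally show ?thesis .
  qed
  have "emeasure \<mu> T \<le> ennreal 0"
  proof (rule tendsto_lowerbound)
    have "((\<lambda>\<epsilon>. C * (\<epsilon> / \<rho>) powr \<alpha> * M') \<longlongrightarrow> C * (0 / \<rho>) powr \<alpha> * M') (at_right 0)"
      using C(2) \<rho>(1) by (intro tendsto_intros tendsto_powr') (auto simp: eventually_at_right_less intro!: eventually_mono[OF eventually_at_right_less[of 0]])
    then have "((\<lambda>\<epsilon>. C * (\<epsilon> / \<rho>) powr \<alpha> * M') \<longlongrightarrow> 0) (at_right 0)" by simp
    then show "((\<lambda>\<epsilon>. ennreal (C * (\<epsilon> / \<rho>) powr \<alpha> * M')) \<longlongrightarrow> ennreal 0) (at_right 0)"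
      by (rule tendsto_ennrealI)
    show "\<forall>\<^sub>F \<epsilon> in at_right 0. emeasure \<mu> T \<le> ennreal (C * (\<epsilon> / \<rho>) powr \<alpha> * M')"
      using eventually_at_right_real[OF \<rho>(1)] by eventually_elim (auto intro: bound)
  qed simp
  then show ?thesis using T unfolding T_def by (auto simp: null_sets_def)
qed

theorem theorem3p6:
  fixes \<mu> :: "'a :: metric_space measure"
    and f :: "'a \<Rightarrow> real ^ 'n"
    and x :: 'a and r :: real
    and B B' :: "'a set"
  assumes "besicovitch_space TYPE('a)"
    and "federer_measure \<mu>"
    and "r > 0"
    and "B = ball x r"
    and "B' = ball x (3 ^ (CARD('n) + 1) * r)"
    and "emeasure \<mu> B' < \<infinity>"
    and "continuous_on B' f"
    and "\<exists>C>0. \<exists>\<alpha>>0. \<forall>k. \<forall>\<Gamma>\<in>primitive_submodules.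
           good_on C \<alpha> \<mu> B' (\<lambda>z. cov ((*v) (g_mat k ** u_mat (f z)) ` \<Gamma>))"
    and "\<exists>c>0. \<exists>k :: nat \<Rightarrow> nat. filterlim k at_top sequentially \<and>
           (\<forall>i. \<forall>\<Gamma>\<in>primitive_submodules.
              (SUP z \<in> B \<inter> msupp \<mu>. ennreal (cov ((*v) (g_mat (k i) ** u_mat (f z)) ` \<Gamma>)))
                \<ge> ennreal (c ^ dim \<Gamma>))"
  shows "{z \<in> B. singular_vector (f z)} \<in> null_sets \<mu>"
proof -
  note bes = assms(1)
  define \<psi> where "\<psi> k \<Gamma> z = cov ((*v) (g_mat k ** u_mat (f z)) ` \<Gamma>)" for k \<Gamma> z
  obtain C \<alpha> where C: "0 < C" "0 < \<alpha>"
    "\<And>k \<Gamma>. \<Gamma> \<in> primitive_submodules \<Longrightarrow> good_on C \<alpha> \<mu> B' (\<psi> k \<Gamma>)"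
    using assms(8) unfolding \<psi>_def by blast
  obtain c and k :: "nat \<Rightarrow> nat" where c: "0 < c" and k: "filterlim k at_top sequentially"
    and sup: "\<And>i \<Gamma>. \<Gamma> \<in> primitive_submodules \<Longrightarrow>
      ennreal (c ^ dim \<Gamma>) \<le> (SUP z \<in> B \<inter> msupp \<mu>. ennreal (\<psi> (k i) \<Gamma> z))"
    using assms(9) unfolding \<psi>_def by blast
  have sets: "sets \<mu> = sets borel" using assms(2) by (simp add: federer_measure_def)
  define fed where "fed z U D \<longleftrightarrow> open U \<and> z \<in> U \<and> D > 0 \<and>
      (SUP (y, \<rho>) \<in> {(y, \<rho>). y \<in> msupp \<mu> \<and> \<rho> > 0 \<and> ball y (3 * \<rho>) \<subseteq> U}.
          emeasure \<mu> (ball y (3 * \<rho>)) / emeasure \<mu> (ball y \<rho>)) < ennreal D" for z U D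
  have "AE z in \<mu>. \<exists>U D. fed z U D"
    using assms(2)[unfolded federer_measure_def, THEN conjunct2]
    by (rule eventually_mono) (unfold fed_def, blast)
  then obtain N0 where N0: "{z \<in> space \<mu>. \<not> (\<exists>U D. fed z U D)} \<subseteq> N0" "N0 \<in> null_sets \<mu>"
    unfolding eventually_ae_filter by blast
  \<comment> \<open>Index types are nonempty, so n \<ge> 1 and B' has radius at least
    \<open>9 * r\<close>; this leaves room for \<open>ball z (2 * r)\<close> with z in B.\<close>
  have "(3::real) ^ 2 \<le> 3 ^ (CARD('n) + 1)"
    by (rule power_increasing) (auto simp: Suc_leI)
  then have "9 * r \<le> 3 ^ (CARD('n) + 1) * r" using assms(3) by (intro mult_right_mono) auto
  then have B9: "ball x (9 * r) \<subseteq> B'" unfolding assms(5) by (rule subset_ball)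
  have B': "open B'" "bounded B'" "B \<subseteq> B'" using B9 assms(3,4,5) by auto
  have nn: "0 \<le> \<psi> i \<Gamma> z" if "\<Gamma> \<in> primitive_submodules" for i \<Gamma> z
    unfolding \<psi>_def by (rule cov_image_nonneg[OF matrix_vector_mul_linear inj_g_u that])
  have usc: "open {z \<in> B'. \<psi> i \<Gamma> z < e}" if "\<Gamma> \<in> primitive_submodules" for i \<Gamma> e
    unfolding \<psi>_def by (rule open_cov_sublevel[OF B'(1) continuous_on_g_u[OF assms(7)] inj_g_u that])
  \<comment> \<open>Capping c at 1 makes its powers decrease with the rank, so one number serves all
    ranks up to n + 1. Halving makes the inequality strict, so that an actual point beats the
    supremum bound.\<close>
  define \<rho> where "\<rho> = min c 1 ^ (CARD('n) + 1) / 2"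
  have \<rho>: "0 < \<rho>" using c by (simp add: \<rho>_def)
  have largeB: "\<exists>y\<in>B \<inter> msupp \<mu>. \<rho> \<le> \<psi> (k i) \<Gamma> y"
    if \<Gamma>: "\<Gamma> \<in> primitive_submodules" for i and \<Gamma> :: "(real ^ 'n option) set"
  proof -
    have "dim \<Gamma> \<le> CARD('n) + 1" using dim_subset_UNIV[of \<Gamma>] by simp
    then have "2 * \<rho> \<le> min c 1 ^ dim \<Gamma>"
      using c power_decreasing[of "dim \<Gamma>" "CARD('n) + 1" "min c 1"] unfolding \<rho>_def by simp
    also have "\<dots> \<le> c ^ dim \<Gamma>" using c by (intro power_mono) auto
    finally have "ennreal \<rho> < ennreal (c ^ dim \<Gamma>)" using \<rho> by (intro ennreal_lessI) auto
    then have "ennreal \<rho> < (SUP z \<in> B \<inter> msupp \<mu>. ennreal (\<psi> (k i) \<Gamma> z))"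
      using sup[OF \<Gamma>] by (rule less_le_trans)
    then obtain y where "y \<in> B \<inter> msupp \<mu>" "ennreal \<rho> < ennreal (\<psi> (k i) \<Gamma> y)"
      by (auto simp: less_SUP_iff)
    then show ?thesis using \<rho> by (auto simp: ennreal_less_iff intro!: bexI[of _ y])
  qed
  define A where "A = {z \<in> B \<inter> msupp \<mu>. \<exists>U D. fed z U D}"
  have "\<exists>t>0. {y \<in> ball z t. singular_vector (f y)} \<in> null_sets \<mu>" if zA: "z \<in> A" for z
  proof -
    obtain U D where z: "z \<in> B" "z \<in> msupp \<mu>" and fed: "fed z U D" using zA by (auto simp: A_def)
    define V where "V = U \<inter> B'"
    have V: "open V" "z \<in> V" "bounded V" "V \<subseteq> B'" "V \<subseteq> U"
      using fed z B' by (auto simp: V_def fed_def intro: bounded_subset)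
    have Vfin: "emeasure \<mu> V < \<infinity>"
      using emeasure_mono[OF V(4), of \<mu>] B'(1) assms(6) by (auto simp: sets borel_open)
    obtain s where s: "s > 0" "ball z s \<subseteq> V" using V(1,2) by (meson open_contains_ball)
    \<comment> \<open>The enlarged ball of the quantitative estimate must stay in V, where doubling
      holds with the single constant D.\<close>
    define t where "t = min r (s / 7 ^ (CARD('n) + 1))"
    have t: "0 < t" "t \<le> r" "7 ^ (CARD('n) + 1) * t \<le> s"
      using s(1) assms(3) by (auto simp: t_def min_def field_simps)
    have dzx: "dist x z < r" using z(1) assms(4) by simp
    \<comment> \<open>Goodness speaks only of balls centred in the support, and x may lie outside
      it; hypothesis (2) is therefore first moved to a ball about z that contains B.\<close>
    have zB: "B \<subseteq> ball z (2 * r)" "ball z (2 * r) \<subseteq> ball x (9 * r)"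
      using dzx unfolding assms(4) by metric+
    then have z2: "ball z (2 * r) \<subseteq> B'" using B9 by blast
    have fin2: "emeasure \<mu> (ball z (2 * r)) < \<infinity>"
      using emeasure_mono[OF z2, of \<mu>] B'(1) assms(6) by (auto simp: sets borel_open)
    obtain \<rho>' where \<rho>': "0 < \<rho>'" "\<rho>' \<le> 1"
      "\<And>h. good_on C \<alpha> \<mu> B' h \<Longrightarrow> (\<And>y. 0 \<le> h y) \<Longrightarrow> (\<And>e. open {y \<in> B'. h y < e}) \<Longrightarrow>
      \<exists>y\<in>ball z (2 * r) \<inter> msupp \<mu>. \<rho> \<le> h y \<Longrightarrow> \<exists>y\<in>ball z t \<inter> msupp \<mu>. \<rho>' \<le> h y"
      by (rule good_on_large_on_small_ball[OF sets C(1,2) \<rho> z(2) z2 t(1) _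
            null_diff_msupp[OF bes sets bounded_ball open_ball] fin2])
        (use t assms(3) in auto)
    have dbl: "emeasure \<mu> (ball y (3 * u)) \<le> ennreal D * emeasure \<mu> (ball y u)"
      if y: "y \<in> msupp \<mu>" "u > 0" "ball y (3 * u) \<subseteq> V" for y u
    proof -
      let ?a = "emeasure \<mu> (ball y (3 * u))" and ?b = "emeasure \<mu> (ball y u)"
      \<comment> \<open>The quotient can be cleared in \<open>ennreal\<close>: the mass is positive
        since y is in the support, and finite since the ball lies in V.\<close>
      have "0 < ?b" using y(1,2) by (auto simp: msupp_def)
      then have "?b \<noteq> 0" by simp
      have "ball y u \<subseteq> V" using y(2,3) subset_ball[of u "3 * u" y] by auto
      then have "?b \<noteq> \<infinity>"
        using emeasure_mono[of "ball y u" V \<mu>] V(1) Vfin by (auto simp: sets borel_open)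
      have "?a / ?b \<le> (SUP (y, \<rho>) \<in> {(y, \<rho>). y \<in> msupp \<mu> \<and> \<rho> > 0 \<and> ball y (3 * \<rho>) \<subseteq> U}.
          emeasure \<mu> (ball y (3 * \<rho>)) / emeasure \<mu> (ball y \<rho>))"
        using y V(5) by (intro SUP_upper2[of "(y, u)"]) auto
      also have "\<dots> \<le> ennreal D" using fed unfolding fed_def by (elim conjE less_imp_le)
      finally have "?a / ?b * ?b \<le> ennreal D * ?b" by (rule mult_right_mono) simp
      then show ?thesis
        using \<open>?b \<noteq> 0\<close> \<open>?b \<noteq> \<infinity>\<close> by (simp add: ennreal_divide_times ennreal_divide_self less_top[symmetric])
    qed
    have "{y \<in> ball z t. singular_vector (f y)} \<in> null_sets \<mu>"
    proof (rule singular_null_in_small_ball[OF bes sets V(1,3) Vfin _ _ dbl C(1,2) _ z(2) t(1) _ \<rho>'(1,2) k])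
      show "continuous_on V f" using assms(7) V(4) by (rule continuous_on_subset)
      show "ball z (7 ^ (CARD('n) + 1) * t) \<subseteq> V" using subset_ball[OF t(3)] s(2) by blast
      show "good_on C \<alpha> \<mu> V (\<lambda>z. cov ((*v) (g_mat k ** u_mat (f z)) ` \<Gamma>))"
        if "\<Gamma> \<in> primitive_submodules" for k \<Gamma>
        using good_on_subset[OF C(3)[OF that] V(4)] unfolding \<psi>_def by blast
      show "\<exists>y\<in>ball z t \<inter> msupp \<mu>. \<rho>' \<le> cov ((*v) (g_mat (k i) ** u_mat (f y)) ` \<Gamma>)"
        if \<Gamma>: "\<Gamma> \<in> primitive_submodules" for i \<Gamma>
        using \<rho>'(3)[OF C(3)[OF \<Gamma>] nn[OF \<Gamma>] usc[OF \<Gamma>], of "k i"] largeB[OF \<Gamma>, of i] zB(1)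
        unfolding \<psi>_def by blast
    qed simp
    then show ?thesis using t(1) by blast
  qed
  then obtain R where R: "\<And>z. z \<in> A \<Longrightarrow> R z > 0"
    "\<And>z. z \<in> A \<Longrightarrow> {y \<in> ball z (R z). singular_vector (f y)} \<in> null_sets \<mu>" by metis
  obtain N :: nat where N: "\<And>(A::'a set) R. bounded A \<Longrightarrow> (\<And>z. z \<in> A \<Longrightarrow> R z > 0) \<Longrightarrow>
       besicovitch_subcover N A R"
    by (rule besicovitch_cover[OF bes]) blast
  have "bounded A" using B'(2) by (rule bounded_subset) (use B'(3) in \<open>auto simp: A_def\<close>)
  then have "besicovitch_subcover N A R" using R(1) by (rule N)
  then obtain Z where Z: "Z \<subseteq> A" "countable Z" "A \<subseteq> (\<Union>z\<in>Z. ball z (R z))"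
    unfolding besicovitch_subcover_def by blast
  let ?S = "{z \<in> B. singular_vector (f z)}"
  \<comment> \<open>Besicovitch once more stands in for separability and reduces the null balls to
    countably many; the rest lies in the Federer exceptional set or off the support.\<close>
  have "?S \<subseteq> (\<Union>z\<in>Z. {y \<in> ball z (R z). singular_vector (f y)}) \<union> (N0 \<union> (B' - msupp \<mu>))"
  proof
    fix z assume z: "z \<in> ?S"
    have "space \<mu> = UNIV" using sets_eq_imp_space_eq[OF sets] by simp
    then have "z \<in> N0" if "\<not> (\<exists>U D. fed z U D)" using that N0(1) by blast
    then have "z \<in> A \<or> z \<in> N0 \<or> z \<in> B' - msupp \<mu>" using z B'(3) unfolding A_def by blast
    then show "z \<in> (\<Union>z\<in>Z. {y \<in> ball z (R z). singular_vector (f y)}) \<union> (N0 \<union> (B' - msupp \<mu>))"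
      using z Z(3) by blast
  qed
  moreover have "(\<Union>z\<in>Z. {y \<in> ball z (R z). singular_vector (f y)}) \<union> (N0 \<union> (B' - msupp \<mu>)) \<in> null_sets \<mu>"
    using Z(1,2) R(2) N0(2) null_diff_msupp[OF bes sets B'(2,1)]
    by (intro null_sets.Un null_sets_UN') auto
  moreover have "?S \<in> sets \<mu>"
    unfolding sets using assms(4,7) B'(3)
    by (intro singular_preimage_sets) (auto intro: continuous_on_subset)
  ultimately show ?thesis by (rule null_sets_subset[rotated 2])
qed

end
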